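(* There exist constants $c>0$ and $\varepsilon_0>0$ such that for every $\varepsilon\in(0,\varepsilon_0)$ we have $D(\varepsilon)\ge \mathsf{tow}(c\,\varepsilon^{-1/3})$. (In the paper's notation: $D(\varepsilon)\ge \mathsf{tow}(\Theta(\varepsilon^{-1/3}))$.)
   Context: For a graph $G$ and disjoint nonempty vertex sets $A,B$, let $e(A,B)$ be the number of edges with one end in $A$ and the other in $B$, and $\deg(v,B)$ the number of neighbours of $v$ in $B$. A pair $(A,B)$ of disjoint nonempty vertex sets is $\varepsilon$-degular if there exist $A^-\subseteq A$, $B^-\subseteq B$ with $|A^-|\le\varepsilon|A|$, $|B^-|\le\varepsilon|B|$ such that $\left|\deg(a,B)-\frac{e(A,B)}{|A|}\right|\le\varepsilon|B|$ for every $a\in A\setminus A^-$ and $\left|\deg(b,A)-\frac{e(A,B)}{|B|}\right|\le\varepsilon|A|$ for every $b\in B\setminus B^-$. A partition $V(G)=V_1\sqcup\dots\sqcup V_\ell$ is an $\varepsilon$-degular partition of complexity $\ell$ if (i) $\big||V_i|-|V_j|\big|\le 1$ for all $i,j\in[\ell]$, and (ii) for each $i\in[\ell]$, for at least $(1-\varepsilon)\ell$ indices $j\in[\ell]\setminus\{i\}$ the pair $(V_i,V_j)$ is $\varepsilon$-degular. Define $D(\varepsilon)=\sup_G \min\{\ell : G \text{ has an } \varepsilon\text{-degular partition of complexity } \ell\}$, the supremum over all finite graphs $G$. The tower function $\mathsf{tow}:[0,\infty)\to\mathbb{N}$ is defined by $\mathsf{tow}(x)=1$ for $x\in[0,1)$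 and $\mathsf{tow}(1+x)=2^{\mathsf{tow}(x)}$ for $x\ge 0$. *)

theory Defs
  imports Complex_Main "HOL-Library.Ramsey" "HOL-Library.Extended_Nat" "HOL-Library.Disjoint_Sets"
begin

definition finite_graph :: "'a set \<Rightarrow> 'a set set \<Rightarrow> bool" where
  "finite_graph V E \<longleftrightarrow> finite V \<and> E \<subseteq> nsets V 2"

definition edges_between :: "'a set set \<Rightarrow> 'a set \<Rightarrow> 'a set \<Rightarrow> nat" where
  "edges_between E A B = card {e \<in> E. \<exists>a\<in>A. \<exists>b\<in>B. e = {a, b}}"

definition deg_in :: "'a set set \<Rightarrow> 'a \<Rightarrow> 'a set \<Rightarrow> nat" where
  "deg_in E v B = card {u \<in> B. {v, u} \<in> E}"

definition degular :: "real \<Rightarrow> 'a set set \<Rightarrow> 'a set \<Rightarrow> 'a set \<Rightarrow> bool" where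
  "degular \<epsilon> E A B \<longleftrightarrow>
     A \<noteq> {} \<and> B \<noteq> {} \<and> A \<inter> B = {} \<and>
     (\<exists>A' B'. A' \<subseteq> A \<and> B' \<subseteq> B \<and>
        real (card A') \<le> \<epsilon> * real (card A) \<and>
        real (card B') \<le> \<epsilon> * real (card B) \<and>
        (\<forall>a \<in> A - A'.
           \<bar>real (deg_in E a B) - real (edges_between E A B) / real (card A)\<bar>
             \<le> \<epsilon> * real (card B)) \<and>
        (\<forall>b \<in> B - B'.
           \<bar>real (deg_in E b A) - real (edges_between E A B) / real (card B)\<bar>
             \<le> \<epsilon> * real (card A)))"

definition degular_partition ::
    "real \<Rightarrow> 'a set \<Rightarrow> 'a set set \<Rightarrow> nat \<Rightarrow> (nat \<Rightarrow> 'a set) \<Rightarrow> bool" where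
  "degular_partition \<epsilon> V E l P \<longleftrightarrow>
     disjoint_family_on P {1..l} \<and> (\<Union>i\<in>{1..l}. P i) = V \<and>
     (\<forall>i\<in>{1..l}. \<forall>j\<in>{1..l}. \<bar>int (card (P i)) - int (card (P j))\<bar> \<le> 1) \<and>
     (\<forall>i\<in>{1..l}.
        real (card {j \<in> {1..l} - {i}. degular \<epsilon> E (P i) (P j)}) \<ge> (1 - \<epsilon>) * real l)"

definition has_degular_partition :: "real \<Rightarrow> 'a set \<Rightarrow> 'a set set \<Rightarrow> nat \<Rightarrow> bool" where
  "has_degular_partition \<epsilon> V E l \<longleftrightarrow> (\<exists>P. degular_partition \<epsilon> V E l P)"

definition min_complexity :: "real \<Rightarrow> 'a set \<Rightarrow> 'a set set \<Rightarrow> nat" where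
  "min_complexity \<epsilon> V E = (LEAST l. has_degular_partition \<epsilon> V E l)"

(* Every finite graph is isomorphic to one with vertices in nat.
   For 0 < \<epsilon> < 1 the bound (1 - \<epsilon>) l \<le> l - 1 forces l \<ge> 1/\<epsilon>, and the parts must be nonempty, so
   a nonempty graph with fewer than 1/\<epsilon> vertices has no \<epsilon>-degular partition and the minimum does
   not exist (one with at least 1/\<epsilon> vertices has the partition into singletons). The supremum
   ranges over the graphs for which the minimum exists; giving the others the value \<infinity> would
   make D trivially infinite. It is taken in enat, so it does not presuppose finiteness. *)
definition D :: "real \<Rightarrow> enat" where
  "D \<epsilon> = (SUP (V, E) \<in> {(V :: nat set, E). finite_graph V E \<and>
                                    (\<exists>l. has_degular_partition \<epsilon> V E l)}.
            enat (min_complexity \<epsilon> V E))"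

(* Only arguments x \<ge> 0 are meaningful. *)
function tow :: "real \<Rightarrow> nat" where
  "tow x = (if x < 1 then 1 else 2 ^ tow (x - 1))"
  by auto
termination
proof (relation "measure (\<lambda>x. nat \<lfloor>x\<rfloor>)")
  fix x :: real
  assume "\<not> x < 1"
  then have "\<lfloor>x\<rfloor> \<ge> 1"
    by simp
  then show "(x - 1, x) \<in> measure (\<lambda>x. nat \<lfloor>x\<rfloor>)"
    by simp
qed simp

declare tow.simps [simp del]

lemma tow_less_one: "x < 1 \<Longrightarrow> tow x = 1"
  by (simp add: tow.simps)

lemma tow_add_one: "x \<ge> 0 \<Longrightarrow> tow (1 + x) = 2 ^ tow x"
  by (simp add: tow.simps [of "1 + x"])

end

(*
  Clusters of level t are residue classes modulo m t, where m (t + 1) = m t * k t and k t is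
  exponential in m t. The k t subclusters of a cluster are labelled by sign vectors indexed by the
  clusters of level t, any two of which disagree on at least 1/8 of the coordinates. The edge
  density between u and v is 1/2 plus 1/(4s) times the sum, over the levels t < s, of the sign of
  u's label at v's cluster and of v's label at u's cluster. The labels are balanced, so that later
  levels do not change the degree of a vertex into a cluster of level t. Hence two vertices that
  part ways exactly at level t + 1 have degrees into the clusters of level t that differ by
  n/(32 s) in total.

  If every part of a degular partition almost lies in a cluster of each level up to t, this total
  is seen by the degrees into the parts. Two vertices of a part Z whose level t + 1 clusters differ
  therefore cannot both be typical for almost all pairs (Z, Z'). Counting atypical
  (vertex, part) pairs shows that Z almost lies in a cluster of level t + 1, with the same
  error as before: all error comes from the degularity and not from the previous levels. The
  induction thus runs through s levels whenever epsilon is at most a constant times 1/s^2, which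
  is more than the theorem needs.
*)
theory Submission
  imports Defs
begin

section \<open>Balanced sign codes\<close>

text \<open>The Hamming ball of radius \<open>N / 8\<close> around the empty set; the balls around
  other sets are its translates under \<open>sym_diff\<close>.\<close>

definition small_sets :: "nat \<Rightarrow> nat set set" where
  "small_sets N = {A. A \<subseteq> {..<N} \<and> 8 * card A < N}"

lemma finite_small_sets: "finite (small_sets N)"
  unfolding small_sets_def by (rule finite_subset[of _ "Pow {..<N}"]) auto

text \<open>Give a set \<open>A\<close> the weight \<open>(1/4) ^ card A\<close>. All subsets
  together weigh \<open>(5/4) ^ N\<close>, and a small set weighs at least
  \<open>(1/4) ^ (N div 8)\<close>. Eighth powers avoid fractional exponents, and
  \<open>(5/4) ^ 8 * 4 < 24\<close>.\<close>

lemma card_small_sets: "card (small_sets N) ^ 8 \<le> 24 ^ N"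
proof -
  define d where "d = N div 8"
  have "real (card (small_sets N)) * (1/4) ^ d = (\<Sum>A\<in>small_sets N. (1/4) ^ d)"
    by simp
  also have "\<dots> \<le> (\<Sum>A\<in>small_sets N. (1/4) ^ card A)"
    by (intro sum_mono power_decreasing) (auto simp: small_sets_def d_def)
  also have "\<dots> \<le> (\<Sum>A\<in>Pow {..<N}. (1/4) ^ card A)"
    by (intro sum_mono2) (auto simp: small_sets_def)
  also have "\<dots> = (\<Prod>i<N. 1/4 + 1)"
    by (subst prod_add) auto
  finally have "real (card (small_sets N)) \<le> (5/4) ^ N * 4 ^ d"
    by (simp add: field_simps)
  then have "real (card (small_sets N)) ^ 8 \<le> ((5/4) ^ N * 4 ^ d) ^ 8"
    by (intro power_mono) auto
  also have "\<dots> = ((5/4) ^ 8) ^ N * 4 ^ (8 * d)"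
    by (simp add: power_mult_distrib flip: power_mult) (simp add: mult.commute)
  also have "\<dots> \<le> ((5/4) ^ 8) ^ N * 4 ^ N"
    by (intro mult_left_mono power_increasing) (auto simp: d_def)
  also have "\<dots> = ((5/4) ^ 8 * 4) ^ N"
    by (simp add: power_mult_distrib)
  also have "\<dots> \<le> 24 ^ N"
    by (intro power_mono) (auto simp: eval_nat_numeral)
  finally have "real (card (small_sets N) ^ 8) \<le> real (24 ^ N)"
    by simp
  then show ?thesis
    by (simp only: of_nat_le_iff)
qed

text \<open>The Gilbert--Varshamov argument. Complements are also kept apart, so that the family can be
  closed under negation.\<close>

lemma ex_separated_family:
  assumes "N > 0"
  obtains C where "C \<subseteq> Pow {..<N}" "8 ^ N \<le> (2 * card C) ^ 8"
    "\<And>A B. A \<in> C \<Longrightarrow> B \<in> C \<Longrightarrow> A \<noteq> B \<Longrightarrow>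
       N \<le> 8 * card (sym_diff A B) \<and> 8 * card (sym_diff A B) \<le> 7 * N"
proof -
  define S where "S = {..<N}"
  define far where "far A B \<longleftrightarrow> N \<le> 8 * card (sym_diff A B) \<and> 8 * card (sym_diff A B) \<le> 7 * N"
    for A B :: "nat set"
  define ok where "ok C \<longleftrightarrow> C \<subseteq> Pow S \<and> (\<forall>A\<in>C. \<forall>B\<in>C. A \<noteq> B \<longrightarrow> far A B)" for C
  have far_sym: "far A B \<longleftrightarrow> far B A" for A B
    by (simp add: far_def Un_commute)
  have "ok {}" by (simp add: ok_def)
  moreover have "\<forall>C. ok C \<longrightarrow> card C < Suc (card (Pow S))"
    by (auto simp: ok_def S_def less_Suc_eq_le intro!: card_mono)
  ultimately obtain C where C: "ok C" and max: "\<And>C'. ok C' \<Longrightarrow> card C' \<le> card C"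
    using ex_has_greatest_nat[of ok "{}" card "Suc (card (Pow S))"] by metis
  have CS: "C \<subseteq> Pow S" using C by (simp add: ok_def)
  then have finC: "finite C" by (rule finite_subset) (simp add: S_def)
  have cover: "\<exists>A\<in>C. \<not> far A B" if B: "B \<subseteq> S" for B
  proof (rule ccontr)
    assume *: "\<not> ?thesis"
    then have "B \<notin> C" using assms by (auto simp: far_def)
    moreover have "ok (insert B C)"
      using * C B far_sym by (auto simp: ok_def)
    ultimately show False using max[of "insert B C"] finC by simp
  qed
  \<comment> \<open>A set that is not far from \<open>A\<close> is at distance less than
    \<open>N / 8\<close> from \<open>A\<close> or from its complement. As \<open>C\<close> has
    maximum size, these neighbourhoods cover \<open>Pow S\<close>.\<close>
  define nb where "nb A = (\<lambda>X. sym_diff X A) ` small_sets N \<union> (\<lambda>X. sym_diff (S - X) A) ` small_sets N"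
    for A
  have "Pow S \<subseteq> (\<Union>A\<in>C. nb A)"
  proof
    fix B assume "B \<in> Pow S"
    then obtain A where A: "A \<in> C" "\<not> far A B" and B: "B \<subseteq> S" using cover by blast
    have AS: "A \<subseteq> S" using A CS by blast
    define X where "X = sym_diff A B"
    have X: "X \<subseteq> S" "B = sym_diff X A" "B = sym_diff (S - (S - X)) A"
      using AS B by (auto simp: X_def)
    have "card (S - X) = N - card X" "card X \<le> N"
      using X(1) card_mono[of S X] by (auto simp: S_def card_Diff_subset finite_subset)
    then have "X \<in> small_sets N \<or> S - X \<in> small_sets N"
      using A(2) X(1) by (auto simp: far_def small_sets_def X_def[symmetric] S_def)
    then have "B \<in> nb A" using X(2,3) unfolding nb_def by blast
    then show "B \<in> (\<Union>A\<in>C. nb A)" using A by blast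
  qed
  then have "card (Pow S) \<le> card (\<Union>A\<in>C. nb A)"
    by (intro card_mono) (auto simp: nb_def finC finite_small_sets)
  also have "\<dots> \<le> (\<Sum>A\<in>C. card (nb A))"
    by (rule card_UN_le[OF finC])
  also have "\<dots> \<le> (\<Sum>A\<in>C. 2 * card (small_sets N))"
  proof (rule sum_mono)
    fix A
    show "card (nb A) \<le> 2 * card (small_sets N)"
      unfolding nb_def mult_2
      by (intro order_trans[OF card_Un_le] add_mono card_image_le finite_small_sets)
  qed
  finally have "2 ^ N \<le> 2 * card C * card (small_sets N)"
    by (simp add: card_Pow S_def)
  then have "(2 ^ N) ^ 8 \<le> (2 * card C * card (small_sets N)) ^ 8"
    by (rule power_mono) simp
  also have "\<dots> \<le> (2 * card C) ^ 8 * 24 ^ N"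
    unfolding power_mult_distrib by (intro mult_left_mono card_small_sets) simp
  finally have "(2 ^ N) ^ 8 \<le> (2 * card C) ^ 8 * 24 ^ N" .
  moreover have "((2::nat) ^ N) ^ 8 = (2 ^ 8) ^ N"
    by (simp only: mult.commute flip: power_mult)
  \<comment> \<open>\<open>2 ^ 8 = 256\<close> exceeds \<open>8 * 24\<close>: once
    \<open>24 ^ N\<close>, the bound for the ball, is cancelled, \<open>8 ^ N\<close>
    remains.\<close>
  moreover have "(8 * 24 :: nat) ^ N \<le> (2 ^ 8) ^ N"
    by (rule power_mono) auto
  ultimately have "(8 * 24) ^ N \<le> (2 * card C) ^ 8 * 24 ^ N"
    by (simp only:)
  then have "8 ^ N * 24 ^ N \<le> (2 * card C) ^ 8 * 24 ^ N"
    by (simp only: power_mult_distrib)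
  then have "(8::nat) ^ N \<le> (2 * card C) ^ 8"
    by (simp only: mult_le_cancel2) simp
  with C show thesis
    by (intro that[of C]) (auto simp: ok_def S_def far_def)
qed

lemma sum_split_double:
  fixes f :: "nat \<Rightarrow> 'a::comm_monoid_add"
  shows "(\<Sum>b<2 * N. f b) = (\<Sum>b<N. f b + f (b + N))"
proof -
  have "(\<Sum>b<N + N. f b) = (\<Sum>b<N. f b) + (\<Sum>b=N..<N+N. f b)"
    by (simp add: lessThan_atLeast0 sum.atLeastLessThan_concat)
  also have "(\<Sum>b=N..<N+N. f b) = (\<Sum>b<N. f (b + N))"
    using sum.shift_bounds_nat_ivl[of f 0 N N] by (simp add: lessThan_atLeast0)
  finally show ?thesis by (simp add: sum.distrib mult_2)
qed

text \<open>Row \<open>c x\<close> is the label of subcluster \<open>x\<close>, a sign vector with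
  one entry per cluster. The bound \<open>8 ^ m \<le> k ^ 16\<close> says
  \<open>k \<ge> 2 ^ (3 * m / 16)\<close> without fractional exponents. Evenness of \<open>k\<close>
  lets the coordinates of the next level be paired.\<close>

definition sign_code :: "nat \<Rightarrow> nat \<Rightarrow> (nat \<Rightarrow> nat \<Rightarrow> int) \<Rightarrow> bool" where
  "sign_code m k c \<longleftrightarrow> even k \<and> 0 < k \<and> 8 ^ m \<le> k ^ 16 \<and>
     (\<forall>x b. \<bar>c x b\<bar> = 1) \<and> (\<forall>b<m. (\<Sum>x<k. c x b) = 0) \<and>
     (\<forall>x<k. \<forall>x'<k. x \<noteq> x' \<longrightarrow> m \<le> 8 * card {b. b < m \<and> c x b \<noteq> c x' b})"

text \<open>Each set of a separated family becomes a sign vector on \<open>N\<close> coordinates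
  followed by its negative. Adding the negatives of all these vectors makes every column sum vanish;
  the upper bound \<open>7 * N\<close> on distances keeps vectors and negatives apart.\<close>

lemma ex_sign_code:
  assumes "N > 0"
  obtains k c where "sign_code (2 * N) k c" "\<And>x b. b < N \<Longrightarrow> c x (b + N) = - c x b"
proof -
  obtain C where C: "C \<subseteq> Pow {..<N}" "8 ^ N \<le> (2 * card C) ^ 8"
    "\<And>A B. A \<in> C \<Longrightarrow> B \<in> C \<Longrightarrow> A \<noteq> B \<Longrightarrow>
       N \<le> 8 * card (sym_diff A B) \<and> 8 * card (sym_diff A B) \<le> 7 * N"
    using ex_separated_family[OF assms] by blast
  define K where "K = card C"
  have "finite C" using C(1) by (rule finite_subset) simp
  then obtain h where h: "bij_betw h {..<K} C"
    using ex_bij_betw_nat_finite[of C] by (auto simp: K_def lessThan_atLeast0)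
  have K: "K > 0" using C(2) by (cases "K = 0") (auto simp: K_def)
  define c :: "nat \<Rightarrow> nat \<Rightarrow> int" where
    "c x b = (if x < K then 1 else -1) * (if b < N then 1 else -1) *
       (if b mod N \<in> h (x mod K) then 1 else -1)" for x b
  have c_shift: "c x (b + N) = - c x b" if "b < N" for x b
    using that by (simp add: c_def)
  have "N + N \<le> 8 * card {b. b < 2 * N \<and> c x b \<noteq> c x' b}"
    if x: "x < 2 * K" "x' < 2 * K" "x \<noteq> x'" for x x'
  proof -
    define A where "A = h (x mod K)"
    define B where "B = h (x' mod K)"
    define T where "T = {b. b < N \<and> c x b \<noteq> c x' b}"
    have AB: "A \<in> C" "B \<in> C" using bij_betwE[OF h] K by (auto simp: A_def B_def)
    have fin: "sym_diff A B \<subseteq> {..<N}" using AB C(1) by blast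
    have "{b. b < 2 * N \<and> c x b \<noteq> c x' b} = T \<union> (\<lambda>b. b + N) ` T"
    proof (rule set_eqI)
      fix b
      show "b \<in> {b. b < 2 * N \<and> c x b \<noteq> c x' b} \<longleftrightarrow> b \<in> T \<union> (\<lambda>b. b + N) ` T"
      proof (cases "b < N")
        case False
        then obtain b' where "b = b' + N" using le_iff_add[of N b] by (auto simp: add.commute)
        then show ?thesis by (auto simp: T_def c_shift)
      qed (auto simp: T_def)
    qed
    moreover have "card (T \<union> (\<lambda>b. b + N) ` T) = card T + card ((\<lambda>b. b + N) ` T)"
      by (rule card_Un_disjoint) (auto simp: T_def)
    moreover have "card ((\<lambda>b. b + N) ` T) = card T" by (rule card_image) simp
    moreover have "N \<le> 8 * card T"
    proof (cases "x < K \<longleftrightarrow> x' < K")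
      case True
      have "x mod K \<noteq> x' mod K"
      proof (cases "x < K")
        case True
        with \<open>x < K \<longleftrightarrow> x' < K\<close> x show ?thesis by simp
      next
        case False
        with \<open>x < K \<longleftrightarrow> x' < K\<close> x show ?thesis
          by (simp add: le_mod_geq)
      qed
      then have "A \<noteq> B" using inj_onD[OF bij_betw_imp_inj_on[OF h], of "x mod K" "x' mod K"] K
        by (auto simp: A_def B_def)
      moreover have "T = sym_diff A B"
        using True fin by (auto simp: T_def c_def A_def B_def)
      ultimately show ?thesis using C(3)[OF AB] by simp
    next
      case False
      \<comment> \<open>Opposite leading signs make the rows disagree exactly off
        \<open>sym_diff A B\<close>. Here \<open>A = B\<close> can occur, when the indices differ by
        \<open>K\<close>; the symmetric difference is then empty.\<close>
      have T: "T = {..<N} - sym_diff A B"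
        using False by (auto simp: T_def c_def A_def B_def)
      have "card T = N - card (sym_diff A B)"
        unfolding T using fin by (subst card_Diff_subset) (auto intro: finite_subset)
      moreover have "8 * card (sym_diff A B) \<le> 7 * N"
        using C(3)[OF AB] by (cases "A = B") auto
      ultimately show ?thesis by linarith
    qed
    ultimately show ?thesis by simp
  qed
  moreover have "(\<Sum>x<2 * K. c x b) = 0" for b
    by (subst sum_split_double, rule sum.neutral) (auto simp: c_def)
  moreover have "8 ^ (2 * N) \<le> (2 * K) ^ 16"
    using power_mono[OF C(2), of 2] by (simp add: K_def mult.commute flip: power_mult)
  moreover have "\<bar>c x b\<bar> = 1" for x b
    by (simp add: c_def)
  ultimately have "sign_code (2 * N) (2 * K) c"
    using K unfolding sign_code_def mult_2[of N] by simp
  then show thesis using c_shift by (rule that)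
qed

text \<open>As \<open>k\<close> is even, half the length, \<open>N = m * (k div 2)\<close>, is a
  multiple of \<open>m\<close>. Shifting by \<open>N\<close> therefore keeps residues modulo
  \<open>d\<close> and negates the entries, which cancel in pairs.\<close>

lemma ex_sign_code_balanced:
  assumes "m > 0" "even k" "k > 0"
  obtains k' c where "sign_code (m * k) k' c"
    "\<And>d y x. d dvd m \<Longrightarrow> (\<Sum>b<m * k. if b mod d = y then c x b else 0) = 0"
proof -
  define N where "N = m * (k div 2)"
  have N: "m * k = 2 * N" "N > 0" using assms by (auto simp: N_def elim!: evenE)
  obtain k' c where c: "sign_code (2 * N) k' c" "\<And>x b. b < N \<Longrightarrow> c x (b + N) = - c x b"
    using ex_sign_code[OF N(2)] by blast
  show thesis
  proof (rule that)
    show "sign_code (m * k) k' c" using c N by simp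
    fix d y x :: nat assume "d dvd m"
    then have "d dvd N" by (simp add: N_def)
    then have "(b + N) mod d = b mod d" for b
      by (metis add.right_neutral mod_add_right_eq mod_0_imp_dvd dvd_imp_mod_0)
    then show "(\<Sum>b<m * k. if b mod d = y then c x b else 0) = 0"
      unfolding N(1) sum_split_double by (intro sum.neutral) (auto simp: c(2))
  qed
qed

section \<open>Towers of codes\<close>

lemma sum_block:
  fixes f :: "nat \<Rightarrow> 'a::comm_monoid_add"
  shows "(\<Sum>b<M * K. f b) = (\<Sum>x<K. \<Sum>v<M. f (v + M * x))"
proof -
  have "(\<Sum>b<M * K. f b) = (\<Sum>x<K. sum f {x * M..<x * M + M})"
    by (simp add: sum.nat_group mult.commute)
  also have "\<dots> = (\<Sum>x<K. \<Sum>v<M. f (v + M * x))"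
  proof (rule sum.cong[OF refl])
    fix x
    show "sum f {x * M..<x * M + M} = (\<Sum>v<M. f (v + M * x))"
      using sum.shift_bounds_nat_ivl[of f 0 "x * M" M]
      by (simp add: lessThan_atLeast0 ac_simps)
  qed
  finally show ?thesis .
qed

lemma sum_mod_period:
  fixes f :: "nat \<Rightarrow> 'a::semiring_1"
  shows "(\<Sum>b<M * q. f (b mod M)) = of_nat q * (\<Sum>b<M. f b)"
proof -
  have "(\<Sum>b<M * q. f (b mod M)) = (\<Sum>x<q. \<Sum>v<M. f v)"
    unfolding sum_block by (intro sum.cong refl) auto
  then show ?thesis by simp
qed

text \<open>\<open>balanced\<close> makes each label of level \<open>Suc t\<close> sum to zero over
  the coordinates inside any cluster of level at most \<open>t\<close>; \<open>sign_code\<close>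
  gives the matching condition on columns. Together they hide later levels from the degrees into
  coarser clusters.\<close>

locale code_tower =
  fixes m k :: "nat \<Rightarrow> nat" and c :: "nat \<Rightarrow> nat \<Rightarrow> nat \<Rightarrow> int"
  assumes m_0: "m 0 = 1"
    and m_Suc: "m (Suc t) = m t * k t"
    and code: "sign_code (m t) (k t) (c t)"
    and balanced: "d dvd m t \<Longrightarrow> (\<Sum>b<m (Suc t). if b mod d = y then c (Suc t) x b else 0) = 0"

lemma ex_code_tower: "\<exists>m k c. code_tower m k c"
proof -
  define P :: "nat \<Rightarrow> nat \<times> nat \<times> (nat \<Rightarrow> nat \<Rightarrow> int) \<Rightarrow> bool" where
    "P t p \<longleftrightarrow> (case p of (m, k, c) \<Rightarrow> 0 < m \<and> (t = 0 \<longrightarrow> m = 1) \<and> sign_code m k c)" for t p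
  define Q :: "nat \<Rightarrow> nat \<times> nat \<times> (nat \<Rightarrow> nat \<Rightarrow> int) \<Rightarrow> nat \<times> nat \<times> (nat \<Rightarrow> nat \<Rightarrow> int) \<Rightarrow> bool" where
    "Q t p p' \<longleftrightarrow> (case p of (m, k, c) \<Rightarrow> case p' of (m', k', c') \<Rightarrow> m' = m * k \<and>
       (\<forall>d y x. d dvd m \<longrightarrow> (\<Sum>b<m'. if b mod d = y then c' x b else 0) = 0))" for t p p'
  have "\<exists>f. \<forall>t. P t (f t) \<and> Q t (f t) (f (Suc t))"
  proof (rule dependent_nat_choice)
    \<comment> \<open>Level \<open>0\<close> has one cluster, whose two subclusters get the
      one-letter labels \<open>1\<close> and \<open>-1\<close>.\<close>
    define c0 :: "nat \<Rightarrow> nat \<Rightarrow> int" where "c0 x b = (if x = 0 then 1 else -1)" for x b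
    have "(\<Sum>x<2. c0 x b) = 0" for b
      by (simp add: c0_def numeral_2_eq_2)
    moreover have "{b. b < 1 \<and> c0 x b \<noteq> c0 x' b} = {0}" if "x < 2" "x' < 2" "x \<noteq> x'" for x x'
      using that by (auto simp: c0_def)
    ultimately have "sign_code 1 2 c0"
      by (simp add: sign_code_def c0_def)
    then have "P 0 (1, 2, c0)" by (simp add: P_def)
    then show "\<exists>p. P 0 p" by blast
  next
    fix p t assume "P t p"
    then obtain m k c where p: "p = (m, k, c)" "0 < m" "sign_code m k c"
      by (auto simp: P_def)
    then have k: "even k" "0 < k" by (auto simp: sign_code_def)
    obtain k' c' where "sign_code (m * k) k' c'"
      "\<And>d y x. d dvd m \<Longrightarrow> (\<Sum>b<m * k. if b mod d = y then c' x b else 0) = 0"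
      using ex_sign_code_balanced[OF p(2) k] by blast
    then have "P (Suc t) (m * k, k', c') \<and> Q t p (m * k, k', c')"
      using p k by (simp add: P_def Q_def)
    then show "\<exists>p'. P (Suc t) p' \<and> Q t p p'" by blast
  qed
  then obtain f where f: "\<And>t. P t (f t)" "\<And>t. Q t (f t) (f (Suc t))" by blast
  have "code_tower (fst \<circ> f) (fst \<circ> snd \<circ> f) (snd \<circ> snd \<circ> f)"
  proof
    show "(fst \<circ> f) 0 = 1" using f(1)[of 0] by (auto simp: P_def split: prod.splits)
  next
    fix t
    show "(fst \<circ> f) (Suc t) = (fst \<circ> f) t * (fst \<circ> snd \<circ> f) t"
      using f(2)[of t] by (auto simp: Q_def split: prod.splits)
    show "sign_code ((fst \<circ> f) t) ((fst \<circ> snd \<circ> f) t) ((snd \<circ> snd \<circ> f) t)"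
      using f(1)[of t] by (auto simp: P_def split: prod.splits)
    fix d y x assume "d dvd (fst \<circ> f) t"
    then show "(\<Sum>b<(fst \<circ> f) (Suc t). if b mod d = y then (snd \<circ> snd \<circ> f) (Suc t) x b else 0) = 0"
      using f(2)[of t] by (auto simp: Q_def split: prod.splits cong: if_cong)
  qed
  then show ?thesis by blast
qed

section \<open>Clusters as residue classes, and the edge weight between them\<close>

context code_tower
begin

lemma k_ge_2: "2 \<le> k t"
  using code[of t] by (auto simp: sign_code_def elim!: evenE)

lemma m_pos: "0 < m t"
  using k_ge_2 by (induction t) (auto simp: m_0 m_Suc intro: less_le_trans[of 0 2])

lemma m_dvd: "r \<le> t \<Longrightarrow> m r dvd m t"
  by (induction rule: dec_induct) (auto simp: m_Suc)

lemma m_mono: "r \<le> t \<Longrightarrow> m r \<le> m t"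
  using m_dvd m_pos by (simp add: dvd_imp_le)

text \<open>The digit of \<open>a\<close> in the mixed radix system with place values
  \<open>m t\<close>: the index of its level \<open>Suc t\<close> cluster inside its level
  \<open>t\<close> cluster.\<close>

definition digit :: "nat \<Rightarrow> nat \<Rightarrow> nat" where
  "digit t a = a mod m (Suc t) div m t"

lemma digit_less: "digit t a < k t"
  unfolding digit_def using m_pos[of "Suc t"]
  by (intro less_mult_imp_div_less) (simp add: m_Suc mult.commute)

lemma digit_mod: "t < s \<Longrightarrow> digit t (a mod m s) = digit t a"
  using m_dvd[of "Suc t" s] by (simp add: digit_def mod_mod_cancel)

lemma digit_eq_iff:
  assumes "a mod m t = b mod m t"
  shows "digit t a = digit t b \<longleftrightarrow> a mod m (Suc t) = b mod m (Suc t)"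
proof
  assume *: "digit t a = digit t b"
  have "x mod m (Suc t) = digit t x * m t + x mod m t" for x
    using div_mult_mod_eq[of "x mod m (Suc t)" "m t"] m_dvd[of t "Suc t"]
    by (simp add: digit_def mod_mod_cancel)
  with * assms show "a mod m (Suc t) = b mod m (Suc t)" by simp
qed (simp add: digit_def)

text \<open>Each vertex reads its own label at the cluster of the other one. Using both orders makes
  the weight symmetric, as an undirected graph requires.\<close>

definition W :: "nat \<Rightarrow> nat \<Rightarrow> nat \<Rightarrow> int" where
  "W s a b = (\<Sum>t<s. c t (digit t a) (b mod m t) + c t (digit t b) (a mod m t))"

lemma W_sym: "W s a b = W s b a"
  by (simp add: W_def add.commute)

lemma W_mod: "W s a (b mod m s) = W s a b"
  unfolding W_def by (intro sum.cong refl) (simp add: digit_mod mod_mod_cancel m_dvd)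

lemma W_bound: "\<bar>W s a b\<bar> \<le> 2 * int s"
proof -
  have "\<bar>c t x b\<bar> = 1" for t x b using code[of t] by (simp add: sign_code_def)
  then have "\<bar>c t (digit t a) (b mod m t) + c t (digit t b) (a mod m t)\<bar> \<le> 2" for t
    using abs_triangle_ineq[of "c t (digit t a) (b mod m t)" "c t (digit t b) (a mod m t)"]
    by simp
  then have "\<bar>W s a b\<bar> \<le> (\<Sum>t<s. 2)"
    unfolding W_def by (intro order_trans[OF sum_abs] sum_mono) auto
  then show ?thesis by simp
qed

text \<open>The summand has period \<open>m t\<close>, and over one period the sum vanishes by
  \<open>balanced\<close> with \<open>d = m r\<close>, which divides \<open>m (t - 1)\<close>
  because \<open>r < t\<close>.\<close>

lemma class_sum_row:
  assumes "r < t" "t < s"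
  shows "(\<Sum>b<m s. if b mod m r = y then c t x (b mod m t) else 0) = 0"
proof -
  obtain q where q: "m s = m t * q" using m_dvd[of t s] assms by auto
  obtain t' where t': "t = Suc t'" using assms by (cases t) auto
  define f where "f b = (if b mod m r = y then c t x b else 0)" for b
  have "(\<Sum>b<m s. if b mod m r = y then c t x (b mod m t) else 0) = (\<Sum>b<m t * q. f (b mod m t))"
    unfolding q using assms by (intro sum.cong refl) (simp add: f_def mod_mod_cancel m_dvd)
  also have "\<dots> = 0"
    unfolding sum_mod_period using balanced[of "m r" t' y x] assms t'
    by (simp add: m_dvd f_def cong: if_cong)
  finally show ?thesis .
qed

text \<open>Membership in a class modulo \<open>m r\<close> does not restrict the digit at the
  higher position \<open>t\<close>. All \<open>k t\<close> digits occur equally often, and column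
  \<open>v\<close> of the code sums to zero.\<close>

lemma class_sum_column:
  assumes "r < t" "t < s" "v < m t"
  shows "(\<Sum>b<m s. if b mod m r = y then c t (digit t b) v else 0) = 0"
proof -
  obtain q where q: "m s = m (Suc t) * q" using m_dvd[of "Suc t" s] assms by auto
  define f where "f b = (if b mod m r = y then c t (b div m t) v else 0)" for b
  have "(\<Sum>b<m s. if b mod m r = y then c t (digit t b) v else 0) = (\<Sum>b<m (Suc t) * q. f (b mod m (Suc t)))"
    unfolding q using assms by (intro sum.cong refl) (simp add: f_def mod_mod_cancel m_dvd digit_def)
  also have "\<dots> = int q * (\<Sum>x<k t. \<Sum>u<m t. f (u + m t * x))"
    unfolding sum_mod_period by (simp add: m_Suc sum_block)
  also have "(\<Sum>x<k t. \<Sum>u<m t. f (u + m t * x)) = (\<Sum>x<k t. \<Sum>u<m t. if u mod m r = y then c t x v else 0)"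
  proof (intro sum.cong refl)
    fix x u assume "u \<in> {..<m t}"
    moreover have "(u + m t * x) mod m r = u mod m r"
      using m_dvd[of r t] assms by (auto elim!: dvdE simp: mult.assoc)
    ultimately show "f (u + m t * x) = (if u mod m r = y then c t x v else 0)" by (simp add: f_def)
  qed
  also have "\<dots> = (\<Sum>u<m t. if u mod m r = y then \<Sum>x<k t. c t x v else 0)"
    by (subst sum.swap) (intro sum.cong refl, auto)
  also have "\<dots> = 0"
    using code[of t] assms(3) by (simp add: sign_code_def cong: if_cong)
  finally show ?thesis by simp
qed

text \<open>Only level \<open>r\<close> survives. Below it \<open>z\<close> and \<open>z'\<close>
  have the same digits and residues; above it the row and column sums vanish. At level
  \<open>r\<close> the sign that depends on \<open>z mod m r\<close> cancels, and the other one is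
  constant on the class, which has \<open>m s div m r\<close> elements.\<close>

lemma W_class_diff:
  assumes "r < s" "y < m r" "z mod m r = z' mod m r"
  shows "(\<Sum>b<m s. if b mod m r = y then W s z b - W s z' b else 0)
       = int (m s div m r) * (c r (digit r z) y - c r (digit r z') y)"
proof -
  define T where "T t w b = c t (digit t w) (b mod m t) + c t (digit t b) (w mod m t)" for t w b
  define S where "S t = (\<Sum>b<m s. if b mod m r = y then T t z b - T t z' b else 0)" for t
  have "(\<Sum>b<m s. if b mod m r = y then W s z b - W s z' b else 0)
      = (\<Sum>b<m s. \<Sum>t<s. if b mod m r = y then T t z b - T t z' b else 0)"
    by (intro sum.cong refl) (simp add: W_def T_def sum_subtractf)
  also have "\<dots> = (\<Sum>t<s. S t)"
    unfolding S_def by (rule sum.swap)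
  also have "\<dots> = (\<Sum>t\<in>{r}. S t)"
  proof (rule sum.mono_neutral_right)
    show "\<forall>t\<in>{..<s} - {r}. S t = 0"
    proof
      fix t assume t: "t \<in> {..<s} - {r}"
      show "S t = 0"
      proof (cases "t < r")
        case True
        have *: "z mod m u = z' mod m u" if "u \<le> r" for u
          using assms(3) m_dvd[OF that] by (metis mod_mod_cancel)
        have "T t z b = T t z' b" for b
          using *[of t] *[of "Suc t"] True by (simp add: T_def digit_def)
        then show ?thesis unfolding S_def by (intro sum.neutral) simp
      next
        case False
        with t have rt: "r < t" "t < s" by auto
        have "(\<Sum>b<m s. if b mod m r = y then T t w b else 0) = 0" for w
        proof -
          have "(\<Sum>b<m s. if b mod m r = y then T t w b else 0)
            = (\<Sum>b<m s. if b mod m r = y then c t (digit t w) (b mod m t) else 0)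
            + (\<Sum>b<m s. if b mod m r = y then c t (digit t b) (w mod m t) else 0)"
            unfolding sum.distrib[symmetric] T_def by (intro sum.cong) auto
          then show ?thesis
            using class_sum_row[OF rt] class_sum_column[OF rt, of "w mod m t"] m_pos by simp
        qed
        moreover have "S t = (\<Sum>b<m s. if b mod m r = y then T t z b else 0)
            - (\<Sum>b<m s. if b mod m r = y then T t z' b else 0)"
          unfolding sum_subtractf[symmetric] S_def by (intro sum.cong) auto
        ultimately show ?thesis by simp
      qed
    qed
  qed (use assms in auto)
  also have "\<dots> = (\<Sum>b<m s. if b mod m r = y then c r (digit r z) y - c r (digit r z') y else 0)"
    by (simp add: S_def T_def assms(3) cong: if_cong)
  also have "\<dots> = int (m s div m r) * (c r (digit r z) y - c r (digit r z') y)"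
  proof -
    obtain q where q: "m s = m r * q" using m_dvd[of r s] assms by auto
    have "(\<Sum>b<m s. if b mod m r = y then D else 0) = int q * (\<Sum>b<m r. if b = y then D else 0)" for D :: int
      unfolding q using sum_mod_period[of "\<lambda>b. if b = y then D else 0" "m r" q] by simp
    then show ?thesis using assms m_pos[of r] by (simp add: q)
  qed
  finally show ?thesis .
qed

text \<open>The labels of \<open>z\<close> and \<open>z'\<close> at level \<open>r\<close> are those
  of different subclusters, so they disagree on at least \<open>m r / 8\<close> coordinates. Each of
  these contributes \<open>2 * (m s div m r)\<close> by \<open>W_class_diff\<close>.\<close>

lemma W_separation:
  assumes "r < s" "z mod m r = z' mod m r" "z mod m (Suc r) \<noteq> z' mod m (Suc r)"
  shows "int (m s) \<le> 4 * (\<Sum>y<m r. \<bar>\<Sum>b<m s. if b mod m r = y then W s z b - W s z' b else 0\<bar>)"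
proof -
  define x where "x = digit r z"
  define x' where "x' = digit r z'"
  define B where "B = {b. b < m r \<and> c r x b \<noteq> c r x' b}"
  have x: "x < k r" "x' < k r" "x \<noteq> x'"
    using assms digit_less digit_eq_iff by (auto simp: x_def x'_def)
  obtain q where q: "m s = m r * q" using m_dvd[of r s] assms by auto
  have "m r \<le> 8 * card B" using code[of r] x by (simp add: sign_code_def B_def)
  then have "int (m s) \<le> int q * (8 * int (card B))"
    unfolding q by (metis mult.commute mult_le_mono2 of_nat_le_iff of_nat_mult of_nat_numeral)
  also have "\<dots> \<le> int q * (4 * (\<Sum>y<m r. \<bar>c r x y - c r x' y\<bar>))"
  proof (rule mult_left_mono)
    have "8 * int (card B) = 4 * (\<Sum>y\<in>B. 2)" by simp
    also have "(\<Sum>y\<in>B. 2) \<le> (\<Sum>y\<in>B. \<bar>c r x y - c r x' y\<bar>)"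
    proof (rule sum_mono)
      fix y assume "y \<in> B"
      moreover have "\<bar>c r x y\<bar> = 1" "\<bar>c r x' y\<bar> = 1" using code[of r] by (auto simp: sign_code_def)
      ultimately show "2 \<le> \<bar>c r x y - c r x' y\<bar>" by (auto simp: B_def)
    qed
    also have "\<dots> \<le> (\<Sum>y<m r. \<bar>c r x y - c r x' y\<bar>)"
      by (rule sum_mono2) (auto simp: B_def)
    finally show "8 * int (card B) \<le> 4 * (\<Sum>y<m r. \<bar>c r x y - c r x' y\<bar>)" by simp
  qed simp
  also have "\<dots> = 4 * (\<Sum>y<m r. \<bar>int (m s div m r) * (c r x y - c r x' y)\<bar>)"
    using m_pos[of r] by (simp add: q abs_mult sum_distrib_left mult.left_commute)
  also have "\<dots> = 4 * (\<Sum>y<m r. \<bar>\<Sum>b<m s. if b mod m r = y then W s z b - W s z' b else 0\<bar>)"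
    using W_class_diff[OF assms(1) _ assms(2)] by (simp add: x_def x'_def)
  finally show ?thesis .
qed

end

section \<open>Refinement by degular partitions\<close>

lemma deg_in_le: "finite B \<Longrightarrow> deg_in E v B \<le> card B"
  unfolding deg_in_def by (rule card_mono) auto

lemma deg_in_partition:
  assumes "finite I" "\<And>i. i \<in> I \<Longrightarrow> finite (B i)" "disjoint_family_on B I" "(\<Union>i\<in>I. B i) = A"
  shows "deg_in E v A = (\<Sum>i\<in>I. deg_in E v (B i))"
proof -
  have "{u \<in> A. {v, u} \<in> E} = (\<Union>i\<in>I. {u \<in> B i. {v, u} \<in> E})"
    using assms(4) by auto
  moreover have "card (\<Union>i\<in>I. {u \<in> B i. {v, u} \<in> E}) = (\<Sum>i\<in>I. card {u \<in> B i. {v, u} \<in> E})"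
    using assms by (intro card_UN_disjoint) (auto simp: disjoint_family_on_def)
  ultimately show ?thesis by (simp add: deg_in_def)
qed

lemma abs_deg_diff_le:
  assumes "finite B"
  shows "\<bar>real (deg_in E z B) - real (deg_in E z' B)\<bar> \<le> real (card B)"
  using deg_in_le[OF assms, of E z] deg_in_le[OF assms, of E z'] by (simp add: abs_le_iff)

text \<open>The classes other than \<open>y0\<close> contribute at most the number of points outside
  \<open>y0\<close>. The term of \<open>y0\<close> is the total minus the others, which costs this
  number again. So if \<open>B\<close> lies almost in one class, the degrees into \<open>B\<close>
  see the class-wise differences.\<close>

lemma deg_in_split_classes:
  assumes "finite B"
  shows "(\<Sum>y\<in>f ` B. \<bar>real (deg_in E z {u \<in> B. f u = y}) - real (deg_in E z' {u \<in> B. f u = y})\<bar>)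
     \<le> \<bar>real (deg_in E z B) - real (deg_in E z' B)\<bar> + 2 * real (card {u \<in> B. f u \<noteq> y0})"
proof -
  define d where "d y = real (deg_in E z {u \<in> B. f u = y}) - real (deg_in E z' {u \<in> B. f u = y})" for y
  define Y where "Y = f ` B"
  define R where "R = {u \<in> B. f u \<noteq> y0}"
  have fin: "finite Y" "finite R" using assms by (auto simp: Y_def R_def)
  have d: "\<bar>d y\<bar> \<le> real (card {u \<in> B. f u = y})" for y
    unfolding d_def using assms by (intro abs_deg_diff_le) simp
  have total: "real (deg_in E z B) - real (deg_in E z' B) = (\<Sum>y\<in>Y. d y)"
  proof -
    have "deg_in E w B = (\<Sum>y\<in>Y. deg_in E w {u \<in> B. f u = y})" for w
      using assms fin by (intro deg_in_partition) (auto simp: Y_def disjoint_family_on_def)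
    then show ?thesis by (simp add: d_def sum_subtractf)
  qed
  have "card R = (\<Sum>y\<in>Y - {y0}. card {u \<in> B. f u = y})"
  proof -
    have "R = (\<Union>y\<in>Y - {y0}. {u \<in> B. f u = y})" by (auto simp: R_def Y_def)
    then show ?thesis using assms fin by (auto intro!: card_UN_disjoint)
  qed
  then have rest: "(\<Sum>y\<in>Y - {y0}. \<bar>d y\<bar>) \<le> real (card R)"
    using d by (simp add: sum_mono)
  show ?thesis
  proof (cases "y0 \<in> Y")
    case True
    have "(\<Sum>y\<in>Y. g y) = g y0 + (\<Sum>y\<in>Y - {y0}. g y)" for g :: "'b \<Rightarrow> real"
      using fin(1) True by (rule sum.remove)
    from this[of d] this[of "\<lambda>y. \<bar>d y\<bar>"]
    have "(\<Sum>y\<in>Y. \<bar>d y\<bar>) \<le> \<bar>\<Sum>y\<in>Y. d y\<bar> + 2 * real (card R)"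
      using rest sum_abs[of d "Y - {y0}"] by linarith
    then show ?thesis using total by (simp add: d_def Y_def R_def)
  next
    case False
    then have "(\<Sum>y\<in>Y. \<bar>d y\<bar>) \<le> real (card R)" using rest by simp
    then show ?thesis by (simp add: d_def Y_def R_def)
  qed
qed

lemma degular_imp_deg_close:
  assumes "degular \<epsilon> E A B" "finite A"
  obtains X where "X \<subseteq> A" "real (card X) \<le> \<epsilon> * real (card A)"
    "\<And>z z'. z \<in> A - X \<Longrightarrow> z' \<in> A - X \<Longrightarrow>
       \<bar>real (deg_in E z B) - real (deg_in E z' B)\<bar> \<le> 2 * \<epsilon> * real (card B)"
proof -
  obtain X where X: "X \<subseteq> A" "real (card X) \<le> \<epsilon> * real (card A)"
    "\<And>z. z \<in> A - X \<Longrightarrow>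
       \<bar>real (deg_in E z B) - real (edges_between E A B) / real (card A)\<bar> \<le> \<epsilon> * real (card B)"
    using assms(1) unfolding degular_def by blast
  show thesis
  proof (rule that[OF X(1,2)])
    fix z z' assume "z \<in> A - X" "z' \<in> A - X"
    from X(3)[OF this(1)] X(3)[OF this(2)]
    show "\<bar>real (deg_in E z B) - real (deg_in E z' B)\<bar> \<le> 2 * \<epsilon> * real (card B)"
      by linarith
  qed
qed

lemma degular_partition_index_pos:
  assumes P: "degular_partition \<epsilon> V E l P" and "V \<noteq> {}"
  shows "0 < l"
  using assms by (cases l) (auto simp: degular_partition_def)

lemma degular_partition_part_nonempty:
  assumes P: "degular_partition \<epsilon> V E l P" and "V \<noteq> {}" "\<epsilon> < 1" "i \<in> {1..l}"
  shows "P i \<noteq> {}"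
proof -
  have "0 < (1 - \<epsilon>) * real l" using degular_partition_index_pos[OF P] assms by simp
  also have "\<dots> \<le> real (card {j \<in> {1..l} - {i}. degular \<epsilon> E (P i) (P j)})"
    using P assms(4) by (simp add: degular_partition_def)
  finally have "{j \<in> {1..l} - {i}. degular \<epsilon> E (P i) (P j)} \<noteq> {}"
    by (metis card.empty less_irrefl of_nat_0)
  then show ?thesis by (auto simp: degular_def)
qed

text \<open>All parts are nonempty and their sizes differ by at most one, hence by at most a factor
  of two.\<close>

lemma degular_partition_part_size:
  assumes P: "degular_partition \<epsilon> V E l P" and fin: "finite V" and ne: "V \<noteq> {}"
    and \<epsilon>: "\<epsilon> < 1" and i: "i \<in> {1..l}"
  shows "l * card (P i) \<le> 2 * card V"
proof -
  have finP: "finite (P j)" if "j \<in> {1..l}" for j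
    using P fin that by (auto simp: degular_partition_def intro: finite_subset)
  have "card (\<Union>j\<in>{1..l}. P j) = (\<Sum>j\<in>{1..l}. card (P j))"
    using P finP by (intro card_UN_disjoint) (auto simp: degular_partition_def disjoint_family_on_def)
  then have "card V = (\<Sum>j\<in>{1..l}. card (P j))"
    using P by (simp only: degular_partition_def)
  moreover have "card (P i) \<le> 2 * card (P j)" if j: "j \<in> {1..l}" for j
  proof -
    have "card (P j) \<noteq> 0"
      using degular_partition_part_nonempty[OF P ne \<epsilon> j] finP[OF j] by simp
    moreover have "\<bar>int (card (P i)) - int (card (P j))\<bar> \<le> 1"
      using P i j by (simp add: degular_partition_def)
    ultimately show ?thesis by linarith
  qed
  then have "(\<Sum>j\<in>{1..l}. card (P i)) \<le> (\<Sum>j\<in>{1..l}. 2 * card (P j))"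
    by (rule sum_mono)
  ultimately show ?thesis by (simp add: sum_distrib_left)
qed

text \<open>\<open>bad z\<close> collects the indices \<open>j\<close> for which the pair is not
  degular, including \<open>j = i\<close>, and those for which \<open>z\<close> is exceptional.
  There are at most \<open>\<epsilon> * l\<close> of the first kind; the second kind is summed over
  \<open>z\<close> by double counting.\<close>

lemma degular_partition_bad_pairs:
  assumes P: "degular_partition \<epsilon> V E l P" and fin: "finite V" and i: "i \<in> {1..l}" and \<epsilon>: "0 \<le> \<epsilon>"
  shows "\<exists>bad. (\<forall>z. bad z \<subseteq> {1..l}) \<and>
    real (\<Sum>z\<in>P i. card (bad z)) \<le> 2 * \<epsilon> * real l * real (card (P i)) \<and>
    (\<forall>z\<in>P i. \<forall>z'\<in>P i. \<forall>j\<in>{1..l} - (bad z \<union> bad z').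
       \<bar>real (deg_in E z (P j)) - real (deg_in E z' (P j))\<bar> \<le> 2 * \<epsilon> * real (card (P j)))"
proof -
  define G where "G = {j \<in> {1..l} - {i}. degular \<epsilon> E (P i) (P j)}"
  have finPi: "finite (P i)"
    using P fin i by (auto simp: degular_partition_def intro: finite_subset)
  have G: "G \<subseteq> {1..l}" "(1 - \<epsilon>) * real l \<le> real (card G)" "finite G"
    using P i by (auto simp: G_def degular_partition_def)
  have "\<exists>X. X \<subseteq> P i \<and> real (card X) \<le> \<epsilon> * real (card (P i)) \<and>
      (\<forall>z\<in>P i - X. \<forall>z'\<in>P i - X.
         \<bar>real (deg_in E z (P j)) - real (deg_in E z' (P j))\<bar> \<le> 2 * \<epsilon> * real (card (P j)))"
    if "j \<in> G" for j
    using degular_imp_deg_close[of \<epsilon> E "P i" "P j"] that finPi by (metis (lifting) G_def mem_Collect_eq)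
  then obtain X where X: "\<And>j. j \<in> G \<Longrightarrow> X j \<subseteq> P i"
    "\<And>j. j \<in> G \<Longrightarrow> real (card (X j)) \<le> \<epsilon> * real (card (P i))"
    "\<And>j z z'. j \<in> G \<Longrightarrow> z \<in> P i - X j \<Longrightarrow> z' \<in> P i - X j \<Longrightarrow>
         \<bar>real (deg_in E z (P j)) - real (deg_in E z' (P j))\<bar> \<le> 2 * \<epsilon> * real (card (P j))"
    by metis
  define bad where "bad z = ({1..l} - G) \<union> {j \<in> G. z \<in> X j}" for z
  show ?thesis
  proof (intro exI conjI allI ballI)
    show "bad z \<subseteq> {1..l}" for z using G by (auto simp: bad_def)
    show "\<bar>real (deg_in E z (P j)) - real (deg_in E z' (P j))\<bar> \<le> 2 * \<epsilon> * real (card (P j))"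
      if "z \<in> P i" "z' \<in> P i" "j \<in> {1..l} - (bad z \<union> bad z')" for z z' j
      using that by (intro X(3)) (auto simp: bad_def)
    have "card ({1..l} - G) = l - card G" using G by (subst card_Diff_subset) auto
    moreover have "card G \<le> l" using card_mono[OF _ G(1)] by simp
    ultimately have nG: "real (card ({1..l} - G)) \<le> \<epsilon> * real l"
      using G(2) by (simp add: of_nat_diff algebra_simps)
    have "(\<Sum>z\<in>P i. card (bad z)) \<le> (\<Sum>z\<in>P i. card ({1..l} - G) + card {j \<in> G. z \<in> X j})"
      unfolding bad_def by (intro sum_mono card_Un_le)
    also have "\<dots> = card (P i) * card ({1..l} - G) + (\<Sum>z\<in>P i. card {j \<in> G. z \<in> X j})"
      by (simp add: sum.distrib)
    also have "(\<Sum>z\<in>P i. card {j \<in> G. z \<in> X j}) = (\<Sum>j\<in>G. card {z \<in> P i. z \<in> X j})"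
      using sum.swap_restrict[OF finPi G(3), of "\<lambda>_ _. 1::nat" "\<lambda>z j. z \<in> X j"] by simp
    also have "\<dots> = (\<Sum>j\<in>G. card (X j))"
      using X(1) by (intro sum.cong refl arg_cong[of _ _ card]) auto
    finally have "real (\<Sum>z\<in>P i. card (bad z))
        \<le> real (card (P i)) * real (card ({1..l} - G)) + (\<Sum>j\<in>G. real (card (X j)))"
      by (simp flip: of_nat_sum of_nat_mult of_nat_add)
    also have "\<dots> \<le> real (card (P i)) * (\<epsilon> * real l) + (\<Sum>j\<in>G. \<epsilon> * real (card (P i)))"
      using nG X(2) by (intro add_mono mult_left_mono sum_mono) auto
    also have "(\<Sum>j\<in>G. \<epsilon> * real (card (P i))) = real (card G) * (\<epsilon> * real (card (P i)))"
      by simp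
    also have "\<dots> \<le> real l * (\<epsilon> * real (card (P i)))"
      using \<open>card G \<le> l\<close> \<epsilon> by (intro mult_right_mono) auto
    finally show "real (\<Sum>z\<in>P i. card (bad z)) \<le> 2 * \<epsilon> * real l * real (card (P i))"
      by (simp add: algebra_simps)
  qed
qed

text \<open>The induction is strong because two vertices may part at any level below
  \<open>r\<close>. The hypothesis only serves to show that a vertex outside the chosen class has at
  least \<open>\<gamma> / 4 * l\<close> bad indices. At most
  \<open>2 * \<epsilon> * l * card (P i)\<close> bad pairs exist, so such vertices form a proportion
  of at most \<open>8 * \<epsilon> / \<gamma> \<le> \<gamma> / 8\<close>, the same at every
  level.\<close>

lemma degular_partition_refines:
  fixes \<kappa> :: "nat \<Rightarrow> 'a \<Rightarrow> 'b"
  assumes P: "degular_partition \<epsilon> V E l P" and fin: "finite V" and ne: "V \<noteq> {}"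
    and \<epsilon>: "0 < \<epsilon>" "64 * \<epsilon> \<le> \<gamma>\<^sup>2" and \<gamma>: "0 < \<gamma>" "\<gamma> \<le> 1"
    and trivial: "\<And>z z'. z \<in> V \<Longrightarrow> z' \<in> V \<Longrightarrow> \<kappa> 0 z = \<kappa> 0 z'"
    and separated: "\<And>t z z'. t < s \<Longrightarrow> z \<in> V \<Longrightarrow> z' \<in> V \<Longrightarrow> \<kappa> t z = \<kappa> t z' \<Longrightarrow>
      \<kappa> (Suc t) z \<noteq> \<kappa> (Suc t) z' \<Longrightarrow>
      \<gamma> * real (card V) \<le>
        (\<Sum>y\<in>\<kappa> t ` V. \<bar>real (deg_in E z {u \<in> V. \<kappa> t u = y}) - real (deg_in E z' {u \<in> V. \<kappa> t u = y})\<bar>)"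
    and "r \<le> s" "i \<in> {1..l}"
  shows "\<exists>y. 8 * real (card {z \<in> P i. \<kappa> r z \<noteq> y}) \<le> \<gamma> * real (card (P i))"
  using assms(10,11)
proof (induction r arbitrary: i rule: less_induct)
  case (less r i)
  define n where "n = real (card V)"
  have Vn: "n > 0" using fin ne by (simp add: n_def card_gt_0_iff)
  have "\<gamma>\<^sup>2 \<le> \<gamma>" using \<gamma> by (simp add: power2_eq_square mult_left_le)
  with \<epsilon> have \<epsilon>\<gamma>: "64 * \<epsilon> \<le> \<gamma>" by linarith
  have \<epsilon>1: "\<epsilon> < 1" using \<epsilon>\<gamma> \<gamma> by linarith
  have l: "0 < l" using degular_partition_index_pos[OF P ne] .
  have PV: "P j \<subseteq> V" if "j \<in> {1..l}" for j
    using P that by (auto simp: degular_partition_def)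
  have finP: "finite (P j)" if "j \<in> {1..l}" for j
    using PV[OF that] fin by (rule finite_subset)
  have disj: "disjoint_family_on P {1..l}" and UP: "(\<Union>j\<in>{1..l}. P j) = V"
    using P by (auto simp: degular_partition_def)
  have sumP: "(\<Sum>j\<in>{1..l}. real (card (P j))) = n"
  proof -
    have "card (\<Union>j\<in>{1..l}. P j) = (\<Sum>j\<in>{1..l}. card (P j))"
      using disj finP by (intro card_UN_disjoint) (auto simp: disjoint_family_on_def)
    then show ?thesis by (simp only: UP n_def of_nat_sum)
  qed
  obtain bad where bad: "\<And>z. bad z \<subseteq> {1..l}"
    "real (\<Sum>z\<in>P i. card (bad z)) \<le> 2 * \<epsilon> * real l * real (card (P i))"
    "\<And>z z' j. z \<in> P i \<Longrightarrow> z' \<in> P i \<Longrightarrow> j \<in> {1..l} - (bad z \<union> bad z') \<Longrightarrow>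
       \<bar>real (deg_in E z (P j)) - real (deg_in E z' (P j))\<bar> \<le> 2 * \<epsilon> * real (card (P j))"
    using degular_partition_bad_pairs[OF P fin less.prems(2) less_imp_le[OF \<epsilon>(1)]] by blast
  have finbad: "finite (bad z)" for z using bad(1)[of z] by (rule finite_subset) simp
  have Pi_ne: "P i \<noteq> {}"
    using degular_partition_part_nonempty[OF P ne \<epsilon>1 less.prems(2)] .
  \<comment> \<open>By averaging, some vertex has at most the mean number of bad indices. Its class
    is the witness \<open>y\<close>.\<close>
  obtain z' where z': "z' \<in> P i" "real (card (bad z')) \<le> 2 * \<epsilon> * real l"
  proof (rule ccontr)
    assume "\<not> thesis"
    then have "\<forall>z\<in>P i. 2 * \<epsilon> * real l < real (card (bad z))" using that by force
    then have "(\<Sum>z\<in>P i. 2 * \<epsilon> * real l) < (\<Sum>z\<in>P i. real (card (bad z)))"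
      using finP[OF less.prems(2)] Pi_ne by (intro sum_strict_mono) auto
    then show False using bad(2) by (simp add: mult.commute)
  qed
  define X where "X = {z \<in> P i. \<kappa> r z \<noteq> \<kappa> r z'}"
  have many_bad: "\<gamma> / 4 * real l \<le> real (card (bad z))" if z: "z \<in> X" for z
  proof -
    have zi: "z \<in> P i" using z by (simp add: X_def)
    have zV: "z \<in> V" "z' \<in> V" using zi z'(1) PV[OF less.prems(2)] by auto
    \<comment> \<open>The first level at which the classes of \<open>z\<close> and \<open>z'\<close>
      part is positive by \<open>trivial\<close>; \<open>t\<close> is the level before it.\<close>
    have "\<exists>t<r. \<kappa> t z = \<kappa> t z' \<and> \<kappa> (Suc t) z \<noteq> \<kappa> (Suc t) z'"
    proof -
      let ?Q = "\<lambda>t. \<kappa> t z \<noteq> \<kappa> t z'"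
      have "?Q r" using z by (simp add: X_def)
      then obtain t where "t < r" "\<forall>u\<le>t. \<not> ?Q u" "?Q (Suc t)"
        using ex_least_nat_less[of ?Q r] trivial[OF zV] by auto
      then show ?thesis by blast
    qed
    then obtain t where t: "t < r" "\<kappa> t z = \<kappa> t z'" "\<kappa> (Suc t) z \<noteq> \<kappa> (Suc t) z'" by blast
    define \<Delta> where "\<Delta> B = \<bar>real (deg_in E z B) - real (deg_in E z' B)\<bar>" for B
    define C where "C j y = {u \<in> P j. \<kappa> t u = y}" for j y
    have part: "\<Delta> {u \<in> V. \<kappa> t u = y} \<le> (\<Sum>j\<in>{1..l}. \<Delta> (C j y))" for y
    proof -
      have *: "deg_in E w {u \<in> V. \<kappa> t u = y} = (\<Sum>j\<in>{1..l}. deg_in E w (C j y))" for w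
      proof (rule deg_in_partition)
        show "disjoint_family_on (\<lambda>j. C j y) {1..l}"
          using disj by (auto simp: disjoint_family_on_def C_def)
        show "(\<Union>j\<in>{1..l}. C j y) = {u \<in> V. \<kappa> t u = y}"
          using UP by (auto simp: C_def)
      qed (use finP in \<open>auto simp: C_def\<close>)
      show ?thesis
        unfolding \<Delta>_def * of_nat_sum sum_subtractf[symmetric] by (rule sum_abs)
    qed
    \<comment> \<open>By the hypothesis at \<open>t\<close>, all but a proportion
      \<open>\<gamma> / 8\<close> of \<open>P j\<close> lies in one class;
      \<open>deg_in_split_classes\<close> doubles this error.\<close>
    have C_sum: "(\<Sum>y\<in>\<kappa> t ` V. \<Delta> (C j y)) \<le> \<Delta> (P j) + \<gamma> / 4 * real (card (P j))" if j: "j \<in> {1..l}" for j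
    proof -
      have "t < r" "t \<le> s" using t less.prems by auto
      then obtain y0 where y0: "8 * real (card {z \<in> P j. \<kappa> t z \<noteq> y0}) \<le> \<gamma> * real (card (P j))"
        using less.IH[of t j] j by blast
      have "(\<Sum>y\<in>\<kappa> t ` V. \<Delta> (C j y)) = (\<Sum>y\<in>\<kappa> t ` P j. \<Delta> (C j y))"
      proof (rule sum.mono_neutral_right)
        show "\<forall>y\<in>\<kappa> t ` V - \<kappa> t ` P j. \<Delta> (C j y) = 0"
        proof
          fix y assume "y \<in> \<kappa> t ` V - \<kappa> t ` P j"
          then have "C j y = {}" by (auto simp: C_def image_iff)
          then show "\<Delta> (C j y) = 0" by (simp add: \<Delta>_def deg_in_def)
        qed
      qed (use fin PV[OF j] in auto)
      also have "\<dots> \<le> \<Delta> (P j) + 2 * real (card {u \<in> P j. \<kappa> t u \<noteq> y0})"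
        unfolding \<Delta>_def C_def by (rule deg_in_split_classes[OF finP[OF j]])
      finally show ?thesis using y0 by linarith
    qed
    define Bd where "Bd = bad z \<union> bad z'"
    have Bd: "Bd \<subseteq> {1..l}" "finite Bd" using bad(1) finbad by (auto simp: Bd_def)
    have "\<gamma> * n \<le> (\<Sum>y\<in>\<kappa> t ` V. \<Delta> {u \<in> V. \<kappa> t u = y})"
      unfolding n_def \<Delta>_def using t less.prems by (intro separated zV) auto
    also have "\<dots> \<le> (\<Sum>y\<in>\<kappa> t ` V. \<Sum>j\<in>{1..l}. \<Delta> (C j y))"
      by (intro sum_mono part)
    also have "\<dots> = (\<Sum>j\<in>{1..l}. \<Sum>y\<in>\<kappa> t ` V. \<Delta> (C j y))"
      by (rule sum.swap)
    also have "\<dots> \<le> (\<Sum>j\<in>{1..l}. \<Delta> (P j) + \<gamma> / 4 * real (card (P j)))"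
      by (intro sum_mono C_sum)
    also have "\<dots> = (\<Sum>j\<in>{1..l}. \<Delta> (P j)) + \<gamma> / 4 * n"
      by (simp only: sum.distrib sumP sum_distrib_left[symmetric])
    also have "(\<Sum>j\<in>{1..l}. \<Delta> (P j)) = (\<Sum>j\<in>Bd. \<Delta> (P j)) + (\<Sum>j\<in>{1..l} - Bd. \<Delta> (P j))"
      using sum.subset_diff[OF Bd(1)] by (simp add: add.commute)
    also have "(\<Sum>j\<in>{1..l} - Bd. \<Delta> (P j)) \<le> (\<Sum>j\<in>{1..l} - Bd. 2 * \<epsilon> * real (card (P j)))"
      unfolding \<Delta>_def using bad(3)[OF zi z'(1)] by (intro sum_mono) (auto simp: Bd_def)
    also have "\<dots> \<le> (\<Sum>j\<in>{1..l}. 2 * \<epsilon> * real (card (P j)))"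
      using \<epsilon> by (intro sum_mono2) auto
    also have "\<dots> = 2 * \<epsilon> * n"
      by (simp only: sumP sum_distrib_left[symmetric])
    \<comment> \<open>For bad indices only the trivial bound by the size of the part is
      available.\<close>
    also have "(\<Sum>j\<in>Bd. \<Delta> (P j)) \<le> (\<Sum>j\<in>Bd. 2 * n / real l)"
    proof (rule sum_mono)
      fix j assume "j \<in> Bd"
      then have j: "j \<in> {1..l}" using Bd by auto
      have "real (l * card (P j)) \<le> real (2 * card V)"
        using degular_partition_part_size[OF P fin ne \<epsilon>1 j] by (simp only: of_nat_le_iff)
      then have "real (card (P j)) \<le> 2 * n / real l"
        using l by (simp add: n_def field_simps)
      moreover have "\<Delta> (P j) \<le> real (card (P j))"
        unfolding \<Delta>_def by (rule abs_deg_diff_le[OF finP[OF j]])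
      ultimately show "\<Delta> (P j) \<le> 2 * n / real l" by linarith
    qed
    also have "\<dots> = real (card Bd) * (2 * n / real l)" by simp
    finally have "\<gamma> * n \<le> n * (2 * real (card Bd) / real l + 2 * \<epsilon> + \<gamma> / 4)"
      by (simp add: algebra_simps)
    then have "\<gamma> \<le> 2 * real (card Bd) / real l + 2 * \<epsilon> + \<gamma> / 4"
      using Vn by (simp add: mult.commute)
    then have "(\<gamma> * 3 / 4 - 2 * \<epsilon>) * real l \<le> 2 * real (card Bd)"
      using l by (simp add: field_simps)
    moreover have "real (card Bd) \<le> real (card (bad z)) + 2 * \<epsilon> * real l"
      using card_Un_le[of "bad z" "bad z'"] z'(2) unfolding Bd_def by linarith
    \<comment> \<open>The bad indices of \<open>z'\<close> cost a further
      \<open>4 * \<epsilon>\<close>, and \<open>64 * \<epsilon> \<le> \<gamma>\<close> gives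
      \<open>6 * \<epsilon> \<le> \<gamma> / 4\<close>.\<close>
    moreover have "\<gamma> / 2 * real l \<le> (\<gamma> * 3 / 4 - 6 * \<epsilon>) * real l"
      using \<epsilon>\<gamma> \<epsilon>(1) by (intro mult_right_mono) linarith+
    ultimately show ?thesis by (simp add: algebra_simps)
  qed
  have "X \<subseteq> P i" by (auto simp: X_def)
  have "real (card X) * (\<gamma> / 4 * real l) = (\<Sum>z\<in>X. \<gamma> / 4 * real l)" by simp
  also have "\<dots> \<le> (\<Sum>z\<in>X. real (card (bad z)))" by (intro sum_mono many_bad)
  also have "\<dots> \<le> (\<Sum>z\<in>P i. real (card (bad z)))"
    using finP[OF less.prems(2)] \<open>X \<subseteq> P i\<close> by (intro sum_mono2) auto
  also have "\<dots> \<le> 2 * \<epsilon> * real l * real (card (P i))" using bad(2) by simp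
  finally have "(real (card X) * \<gamma>) * real l \<le> (8 * \<epsilon> * real (card (P i))) * real l"
    by (simp add: algebra_simps)
  then have "real (card X) * \<gamma> \<le> 8 * \<epsilon> * real (card (P i))" using l by simp
  then have "(8 * real (card X)) * \<gamma> \<le> 64 * \<epsilon> * real (card (P i))" by linarith
  also have "\<dots> \<le> \<gamma>\<^sup>2 * real (card (P i))"
    using \<epsilon>(2) by (rule mult_right_mono) simp
  finally have "(8 * real (card X)) * \<gamma> \<le> (\<gamma> * real (card (P i))) * \<gamma>"
    by (simp add: power2_eq_square algebra_simps)
  then have "8 * real (card X) \<le> \<gamma> * real (card (P i))"
    using \<gamma>(1) by (rule mult_right_le_imp_le)
  then show ?case unfolding X_def by blast
qed

section \<open>The tower graph\<close>

text \<open>The shift by \<open>h\<close> modulo \<open>q\<close> permutes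
  \<open>{..<q}\<close>.\<close>

lemma card_shifted_mod_less:
  assumes "g \<le> q"
  shows "card {x \<in> {..<q}. (h + x) mod q < g} = g"
proof -
  let ?f = "\<lambda>x. (h + x) mod q"
  have "x = y" if "x \<le> y" "y < q" "?f x = ?f y" for x y
  proof -
    have "q dvd (h + y) - (h + x)"
      using that mod_eq_dvd_iff_nat[of "h + x" "h + y" q] by simp
    then show ?thesis using that by (auto dest: dvd_imp_le)
  qed
  then have inj: "inj_on ?f {..<q}"
    by (intro inj_onI) (metis lessThan_iff nat_le_linear)
  have "?f ` {..<q} = {..<q}"
    using inj by (intro endo_inj_surj) auto
  then have "?f ` {x \<in> {..<q}. ?f x < g} = {..<g}"
    using assms by (auto simp: set_eq_iff image_iff) (metis lessThan_iff less_le_trans)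
  moreover have "inj_on ?f {x \<in> {..<q}. ?f x < g}"
    using inj by (rule inj_on_subset) auto
  ultimately show ?thesis by (metis card_image card_lessThan)
qed

lemma card_residue_class:
  assumes "b < M"
  shows "card {u \<in> {..<M * q}. u mod M = b} = q"
proof -
  have "card {u \<in> {..<M * q}. u mod M = b} = (\<Sum>u<M * q. if u mod M = b then 1 else 0)"
    unfolding card_eq_sum by (rule sum.inter_filter) simp
  also have "\<dots> = q"
    using sum_mod_period[of "\<lambda>u. if u = b then 1::nat else 0" M q] assms by simp
  finally show ?thesis .
qed

context code_tower
begin

text \<open>Between any two clusters of level \<open>s\<close> the graph is a circulant of density \<open>1/2 + W/(4s)\<close>,
  so all degrees into clusters are exact up to the deleted loops.\<close>

definition adj :: "nat \<Rightarrow> nat \<Rightarrow> nat \<Rightarrow> nat \<Rightarrow> bool" where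
  "adj s p u v \<longleftrightarrow>
     int ((u div m s + v div m s) mod (4 * s * p)) < int p * (2 * int s + W s u v)"

text \<open>Every cluster of level \<open>s\<close> has \<open>4 * s * p\<close> vertices. The
  factor \<open>4 * s\<close> lets the density \<open>1/2 + W/(4s)\<close> be attained exactly;
  \<open>p\<close> is a free blow-up factor.\<close>

definition tower_verts :: "nat \<Rightarrow> nat \<Rightarrow> nat set" where
  "tower_verts s p = {..<m s * (4 * s * p)}"

definition tower_edges :: "nat \<Rightarrow> nat \<Rightarrow> nat set set" where
  "tower_edges s p =
     {{u, v} | u v. u \<in> tower_verts s p \<and> v \<in> tower_verts s p \<and> u \<noteq> v \<and> adj s p u v}"

lemma tower_graph: "finite_graph (tower_verts s p) (tower_edges s p)"
  by (auto simp: finite_graph_def tower_verts_def tower_edges_def nsets_def card_insert_if)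

lemma adj_sym: "adj s p u v \<longleftrightarrow> adj s p v u"
  by (simp add: adj_def W_sym[of s u v] add.commute)

text \<open>The cluster of \<open>b\<close> consists of the vertices \<open>b + m s * x\<close> with
  \<open>x < 4 * s * p\<close>. \<open>W_bound\<close> keeps the threshold between \<open>0\<close>
  and \<open>4 * s * p\<close>, so by \<open>card_shifted_mod_less\<close> exactly
  \<open>p * (2 * s + W s z b)\<close> of them satisfy \<open>adj\<close> with
  \<open>z\<close>.\<close>

lemma card_adj_class:
  assumes "r \<le> s"
  shows "int (card {u \<in> tower_verts s p. u mod m r = y \<and> adj s p z u})
       = int p * (\<Sum>b<m s. if b mod m r = y then 2 * int s + W s z b else 0)"
proof -
  define q where "q = 4 * s * p"
  define g where "g b = p * nat (2 * int s + W s z b)" for b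
  have g: "int (g b) = int p * (2 * int s + W s z b)" "g b \<le> q" for b
  proof -
    have W: "0 \<le> 2 * int s + W s z b" "2 * int s + W s z b \<le> 4 * int s"
      using W_bound[of s z b] by linarith+
    show *: "int (g b) = int p * (2 * int s + W s z b)"
      using W by (simp add: g_def)
    have "int (g b) \<le> int p * (4 * int s)"
      unfolding * using W by (intro mult_left_mono) auto
    also have "\<dots> = int q" by (simp add: q_def)
    finally show "g b \<le> q" by simp
  qed
  let ?in = "\<lambda>u. if u mod m r = y \<and> adj s p z u then 1 else 0 :: nat"
  have "card {u \<in> tower_verts s p. u mod m r = y \<and> adj s p z u} = (\<Sum>u<m s * q. ?in u)"
    unfolding card_eq_sum tower_verts_def q_def by (rule sum.inter_filter) simp
  also have "\<dots> = (\<Sum>b<m s. \<Sum>x<q. ?in (b + m s * x))"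
    unfolding sum_block by (rule sum.swap)
  also have "\<dots> = (\<Sum>b<m s. if b mod m r = y then g b else 0)"
  proof (rule sum.cong[OF refl])
    fix b assume b: "b \<in> {..<m s}"
    have "?in (b + m s * x) = (if b mod m r = y then (if (z div m s + x) mod q < g b then 1 else 0) else 0)" for x
    proof -
      have "W s z (b + m s * x) = W s z b"
        using W_mod[of s z "b + m s * x"] b by simp
      moreover have "(b + m s * x) mod m r = b mod m r"
        using m_dvd[OF assms] by (auto elim!: dvdE simp: mult.assoc)
      moreover have "(b + m s * x) div m s = x" using b by simp
      ultimately show ?thesis
        by (simp add: adj_def flip: q_def g(1))
    qed
    then have "(\<Sum>x<q. ?in (b + m s * x)) =
       (if b mod m r = y then (\<Sum>x<q. if (z div m s + x) mod q < g b then 1 else 0) else 0)"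
      by simp
    also have "(\<Sum>x<q. if (z div m s + x) mod q < g b then 1 else 0) = card {x \<in> {..<q}. (z div m s + x) mod q < g b}"
      unfolding card_eq_sum by (rule sum.inter_filter[symmetric]) simp
    also have "\<dots> = g b" by (rule card_shifted_mod_less[OF g(2)])
    finally show "(\<Sum>x<q. ?in (b + m s * x)) = (if b mod m r = y then g b else 0)" .
  qed
  finally show ?thesis
    by (simp add: g(1) sum_distrib_left if_distrib[of int] if_distrib[of "\<lambda>a. int p * a"] cong: if_cong)
qed

text \<open>\<open>adj\<close> may hold between \<open>z\<close> and itself, whereas edges join
  distinct vertices. The discrepancy is one, and only in the class of \<open>z\<close>.\<close>

lemma deg_in_tower_class:
  assumes "z \<in> tower_verts s p"
  shows "\<bar>int (deg_in (tower_edges s p) z {u \<in> tower_verts s p. u mod m r = y})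
      - int (card {u \<in> tower_verts s p. u mod m r = y \<and> adj s p z u})\<bar> \<le> (if y = z mod m r then 1 else 0)"
proof -
  define S where "S = {u \<in> tower_verts s p. u mod m r = y \<and> adj s p z u}"
  have fin: "finite S" by (simp add: S_def tower_verts_def)
  have "{z, u} \<in> tower_edges s p \<longleftrightarrow> u \<in> tower_verts s p \<and> u \<noteq> z \<and> adj s p z u" for u
    using assms adj_sym by (auto simp: tower_edges_def doubleton_eq_iff)
  then have "deg_in (tower_edges s p) z {u \<in> tower_verts s p. u mod m r = y} = card (S - {z})"
    unfolding deg_in_def S_def by (intro arg_cong[of _ _ card]) auto
  moreover have "int (card (S - {z})) = int (card S) - (if z \<in> S then 1 else 0)"
    using fin card_Suc_Diff1[OF fin, of z] by auto
  moreover have "y = z mod m r" if "z \<in> S" using that by (simp add: S_def)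
  ultimately show ?thesis by (auto simp: S_def[symmetric])
qed

text \<open>By \<open>W_separation\<close> the counts of \<open>adj\<close> differ by
  \<open>p * m s / 4\<close> or more in total. The loops at \<open>z\<close> and \<open>z'\<close>
  cost at most \<open>2\<close>, and \<open>p \<ge> 16\<close> leaves at least
  \<open>p * m s / 8\<close>, which is the left-hand side.\<close>

lemma tower_graph_separation:
  assumes "r < s" "16 \<le> p" "z \<in> tower_verts s p" "z' \<in> tower_verts s p"
    and "z mod m r = z' mod m r" "z mod m (Suc r) \<noteq> z' mod m (Suc r)"
  shows "1 / (32 * real s) * real (card (tower_verts s p)) \<le>
    (\<Sum>y<m r. \<bar>real (deg_in (tower_edges s p) z {u \<in> tower_verts s p. u mod m r = y})
            - real (deg_in (tower_edges s p) z' {u \<in> tower_verts s p. u mod m r = y})\<bar>)"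
proof -
  define d where "d w y = int (deg_in (tower_edges s p) w {u \<in> tower_verts s p. u mod m r = y})" for w y
  define a where "a w y = int (card {u \<in> tower_verts s p. u mod m r = y \<and> adj s p w u})" for w y
  define i where "i y = (if y = z mod m r then 1 else 0 :: int)" for y
  have "16 * 1 \<le> p * m s"
    using assms(2) m_pos[of s] by (intro mult_le_mono) auto
  then have pm: "16 \<le> int p * int (m s)" by (metis mult_1_right of_nat_mono of_nat_mult of_nat_numeral)
  have da: "\<bar>d w y - a w y\<bar> \<le> i y" if "w = z \<or> w = z'" for w y
    using that deg_in_tower_class[OF assms(3), of r y] deg_in_tower_class[OF assms(4), of r y] assms(5)
    by (auto simp: d_def a_def i_def)
  have "\<bar>a z y - a z' y\<bar> \<le> \<bar>d z y - d z' y\<bar> + 2 * i y" for y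
    using da[of z y] da[of z' y] by linarith
  then have "(\<Sum>y<m r. \<bar>a z y - a z' y\<bar>) \<le> (\<Sum>y<m r. \<bar>d z y - d z' y\<bar> + 2 * i y)"
    by (intro sum_mono) auto
  also have "\<dots> = (\<Sum>y<m r. \<bar>d z y - d z' y\<bar>) + 2"
    using m_pos[of r] by (simp add: sum.distrib i_def flip: sum_distrib_left)
  finally have le: "(\<Sum>y<m r. \<bar>a z y - a z' y\<bar>) \<le> (\<Sum>y<m r. \<bar>d z y - d z' y\<bar>) + 2" .
  have "a z y - a z' y = int p * (\<Sum>b<m s. if b mod m r = y then W s z b - W s z' b else 0)" for y
  proof -
    have "r \<le> s" using assms by simp
    show ?thesis
      unfolding a_def card_adj_class[OF \<open>r \<le> s\<close>] right_diff_distrib[symmetric] sum_subtractf[symmetric]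
      by (intro arg_cong[of _ _ "\<lambda>x. int p * x"] sum.cong) auto
  qed
  then have "4 * (\<Sum>y<m r. \<bar>a z y - a z' y\<bar>)
      = int p * (4 * (\<Sum>y<m r. \<bar>\<Sum>b<m s. if b mod m r = y then W s z b - W s z' b else 0\<bar>))"
    by (simp add: abs_mult flip: sum_distrib_left)
  also have "\<dots> \<ge> int p * int (m s)"
    using W_separation[OF assms(1,5,6)] by (intro mult_left_mono) auto
  finally have "int p * int (m s) \<le> 8 * (\<Sum>y<m r. \<bar>d z y - d z' y\<bar>)"
    using le pm by linarith
  then have "real_of_int (int p * int (m s)) \<le> real_of_int (8 * (\<Sum>y<m r. \<bar>d z y - d z' y\<bar>))"
    by (simp only: of_int_le_iff)
  moreover have "1 / (32 * real s) * real (card (tower_verts s p)) = real p * real (m s) / 8"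
    using assms(1) by (simp add: tower_verts_def)
  ultimately show ?thesis by (simp add: d_def)
qed

text \<open>Each part lies mostly in one cluster of level \<open>s\<close>, so at most
  \<open>l\<close> clusters are chosen by some part. The clusters in \<open>B\<close>, chosen by
  none, are covered by the remainders \<open>R j\<close>, which contain at most half of all
  vertices. Hence at least half of the \<open>m s\<close> clusters are chosen.\<close>

lemma tower_graph_complexity:
  assumes s: "0 < s" and p: "16 \<le> p" and \<epsilon>: "0 < \<epsilon>" "64 * \<epsilon> \<le> (1 / (32 * real s))\<^sup>2"
    and P: "degular_partition \<epsilon> (tower_verts s p) (tower_edges s p) l P"
  shows "m s \<le> 2 * l"
proof -
  define V where "V = tower_verts s p"
  define q where "q = 4 * s * p"
  define \<gamma> where "\<gamma> = 1 / (32 * real s)"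
  have q: "0 < q" using s p by (simp add: q_def)
  have V: "V = {..<m s * q}" by (simp add: V_def q_def tower_verts_def)
  have fin: "finite V" and ne: "V \<noteq> {}" using m_pos[of s] q by (auto simp: V lessThan_empty_iff)
  have P': "degular_partition \<epsilon> V (tower_edges s p) l P" using P by (simp add: V_def)
  have \<gamma>: "0 < \<gamma>" "\<gamma> \<le> 1" using s by (auto simp: \<gamma>_def)
  \<comment> \<open>Every residue occurs in \<open>V\<close>, so sums over occurring classes are
    sums over \<open>y < m t\<close>.\<close>
  have image: "(\<lambda>v. v mod m t) ` V = {..<m t}" if "t \<le> s" for t
  proof
    have "m t \<le> m s * q" using m_mono[OF that] q by (cases q) auto
    then have "{..<m t} \<subseteq> V" by (auto simp: V)
    then show "{..<m t} \<subseteq> (\<lambda>v. v mod m t) ` V" by force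
  qed (use m_pos in auto)
  have "\<exists>y. 8 * real (card {z \<in> P j. z mod m s \<noteq> y}) \<le> \<gamma> * real (card (P j))" if "j \<in> {1..l}" for j
  proof (rule degular_partition_refines[OF P' fin ne \<epsilon>(1) \<epsilon>(2)[folded \<gamma>_def] \<gamma>,
        where \<kappa> = "\<lambda>t v. v mod m t" and s = s])
    show "z mod m 0 = z' mod m 0" for z z' by (simp add: m_0)
    show "\<gamma> * real (card V) \<le> (\<Sum>y\<in>(\<lambda>v. v mod m t) ` V.
        \<bar>real (deg_in (tower_edges s p) z {u \<in> V. u mod m t = y}) -
         real (deg_in (tower_edges s p) z' {u \<in> V. u mod m t = y})\<bar>)"
      if "t < s" "z \<in> V" "z' \<in> V" "z mod m t = z' mod m t" "z mod m (Suc t) \<noteq> z' mod m (Suc t)" for t z z'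
      using tower_graph_separation[of t s p z z'] that p image[of t] unfolding \<gamma>_def V_def by simp
  qed (use that in auto)
  then obtain y where y: "\<And>j. j \<in> {1..l} \<Longrightarrow>
      8 * real (card {z \<in> P j. z mod m s \<noteq> y j}) \<le> \<gamma> * real (card (P j))"
    by metis
  define B where "B = {..<m s} - y ` {1..l}"
  define R where "R j = {z \<in> P j. z mod m s \<noteq> y j}" for j
  have finP: "finite (P j)" if "j \<in> {1..l}" for j
    using P' that fin by (auto simp: degular_partition_def intro: finite_subset)
  have finR: "finite (R j)" if "j \<in> {1..l}" for j using finP[OF that] by (simp add: R_def)
  have "card (\<Union>j\<in>{1..l}. P j) = (\<Sum>j\<in>{1..l}. card (P j))"
    using P' finP by (intro card_UN_disjoint) (auto simp: degular_partition_def disjoint_family_on_def)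
  then have cardV: "card V = (\<Sum>j\<in>{1..l}. card (P j))"
    using P' by (simp only: degular_partition_def)
  have "card B * q = (\<Sum>b\<in>B. card {u \<in> V. u mod m s = b})"
    unfolding V using card_residue_class[of _ "m s" q] by (simp add: B_def)
  also have "\<dots> = card (\<Union>b\<in>B. {u \<in> V. u mod m s = b})"
    using fin by (subst card_UN_disjoint) (auto simp: B_def)
  also have "\<dots> \<le> card (\<Union>j\<in>{1..l}. R j)"
  proof (rule card_mono)
    show "(\<Union>b\<in>B. {u \<in> V. u mod m s = b}) \<subseteq> (\<Union>j\<in>{1..l}. R j)"
    proof
      fix u assume "u \<in> (\<Union>b\<in>B. {u \<in> V. u mod m s = b})"
      then have u: "u \<in> V" "u mod m s \<notin> y ` {1..l}" by (auto simp: B_def)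
      then obtain j where "j \<in> {1..l}" "u \<in> P j" using P' by (auto simp: degular_partition_def)
      with u show "u \<in> (\<Union>j\<in>{1..l}. R j)" by (auto simp: R_def image_iff)
    qed
  qed (use finR in auto)
  also have "\<dots> \<le> (\<Sum>j\<in>{1..l}. card (R j))"
    by (rule card_UN_le) simp
  finally have "real (card B * q) \<le> (\<Sum>j\<in>{1..l}. real (card (R j)))"
    by (simp only: of_nat_le_iff flip: of_nat_sum)
  also have "\<dots> \<le> (\<Sum>j\<in>{1..l}. 1 / 2 * real (card (P j)))"
  proof (rule sum_mono)
    fix j assume j: "j \<in> {1..l}"
    have "\<gamma> * real (card (P j)) \<le> real (card (P j))"
      using \<gamma> by (intro mult_left_le_one_le) auto
    then show "real (card (R j)) \<le> 1 / 2 * real (card (P j))"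
      using y[OF j] by (simp add: R_def)
  qed
  also have "\<dots> = 1 / 2 * real (card V)"
    unfolding cardV of_nat_sum sum_distrib_left ..
  finally have "2 * real (card B) * real q \<le> real (m s) * real q"
    by (simp add: V)
  then have "2 * real (card B) \<le> real (m s)" using q by simp
  moreover have "m s \<le> card B + l"
  proof -
    have "{..<m s} \<subseteq> B \<union> y ` {1..l}" by (auto simp: B_def)
    then have "card {..<m s} \<le> card (B \<union> y ` {1..l})" by (intro card_mono) (auto simp: B_def)
    also have "\<dots> \<le> card B + card {1..l}"
      by (intro order_trans[OF card_Un_le] add_mono card_image_le) auto
    finally show ?thesis by simp
  qed
  ultimately show ?thesis by linarith
qed

text \<open>One exponential takes two levels, because the code only gives
  \<open>k t \<ge> 2 ^ (3 * m t / 16)\<close>: the first level enlarges \<open>m\<close> enough to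
  absorb the factor \<open>3/16\<close>, the second exponentiates. The factor \<open>2\<close>
  matches \<open>m s \<le> 2 * l\<close> in \<open>tower_graph_complexity\<close>.\<close>

lemma tow_le_m: "x < real i + 1 \<Longrightarrow> 2 * tow x \<le> m (2 * i + 5)"
proof (induction i arbitrary: x)
  case 0
  have "1 * 2 \<le> m 4 * k 4" using m_pos[of 4] k_ge_2[of 4] by (intro mult_le_mono) auto
  then show ?case using 0 m_Suc[of 4] by (simp add: tow_less_one)
next
  case (Suc i)
  define M where "M = m (2 * i + 5)"
  define K where "K = k (2 * i + 5)"
  define L where "L = k (Suc (2 * i + 5))"
  have m2: "m (2 * Suc i + 5) = M * K * L"
    using m_Suc[of "2 * i + 5"] m_Suc[of "Suc (2 * i + 5)"] by (simp add: M_def K_def L_def)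
  have pow: "2 ^ t \<le> m t" for t
  proof (induction t)
    case (Suc t)
    then show ?case using mult_le_mono[OF Suc k_ge_2[of t]] by (simp add: m_Suc mult.commute)
  qed (simp add: m_0)
  \<comment> \<open>The offset \<open>5\<close> gives \<open>M \<ge> 2 ^ 5\<close>, hence
    \<open>K \<ge> 2 ^ 6\<close> and \<open>16 \<le> 3 * K\<close>, as the bound on \<open>L\<close>
    requires.\<close>
  have M: "32 \<le> M"
    using order_trans[OF power_increasing[of 5 "2 * i + 5" "2::nat"] pow[of "2 * i + 5"]]
    by (simp add: M_def)
  have code': "8 ^ m t \<le> k t ^ 16" for t using code[of t] by (simp add: sign_code_def)
  have "(2 ^ 6) ^ 16 = (8::nat) ^ 32" by simp
  also have "\<dots> \<le> 8 ^ M" using M by (intro power_increasing) auto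
  also have "\<dots> \<le> K ^ 16" using code' by (simp add: M_def K_def)
  finally have K: "2 ^ 6 \<le> K" by (subst (asm) power_mono_iff) auto
  have "(2 ^ M) ^ 16 = (2::nat) ^ (M * 16)" by (simp only: power_mult)
  also have "\<dots> \<le> 2 ^ (3 * (M * K))"
  proof (rule power_increasing)
    have "M * 16 \<le> M * (3 * K)" using K by (intro mult_le_mono2) simp
    then show "M * 16 \<le> 3 * (M * K)" by simp
  qed simp
  also have "\<dots> = (2 ^ 3) ^ (M * K)" by (simp only: power_mult)
  also have "\<dots> = 8 ^ m (Suc (2 * i + 5))" unfolding m_Suc M_def K_def by simp
  also have "\<dots> \<le> L ^ 16" using code' by (simp add: L_def)
  finally have L: "2 ^ M \<le> L" by (subst (asm) power_mono_iff) auto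
  show ?case
  proof (cases "x < 1")
    case True
    have "1 \<le> L" using L one_le_power[of "2::nat" M] by linarith
    then have "2 * 1 * 1 \<le> M * K * L"
      using M K by (intro mult_le_mono) auto
    then show ?thesis unfolding m2 using True by (simp add: tow_less_one)
  next
    case False
    then have t: "tow x = 2 ^ tow (x - 1)" by (subst tow.simps) simp
    have "2 * tow (x - 1) \<le> M" unfolding M_def using Suc.prems by (intro Suc.IH) simp
    then have "(2::nat) ^ tow (x - 1) \<le> 2 ^ M" by (intro power_increasing) auto
    with L have "tow x \<le> L" unfolding t by linarith
    moreover have "2 * 1 \<le> M * K" using M K by (intro mult_le_mono) auto
    ultimately have "(2 * 1) * tow x \<le> (M * K) * L" by (rule mult_le_mono[rotated])
    then show ?thesis unfolding m2 by simp
  qed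
qed

end

text \<open>Degrees between singletons equal their averages, so all pairs of distinct parts are
  degular. This makes the minimum complexity exist for graphs with enough vertices.\<close>

lemma singleton_degular_partition:
  assumes "1 / \<epsilon> \<le> real n" "0 < \<epsilon>"
  shows "has_degular_partition \<epsilon> {..<n} E n"
proof -
  define P where "P i = {i - 1}" for i :: nat
  have "degular \<epsilon> E (P i) (P j)" if "i \<in> {1..n}" "j \<in> {1..n} - {i}" for i j
  proof -
    define a where "a = i - 1"
    define b where "b = j - 1"
    have "a \<noteq> b" using that by (auto simp: a_def b_def)
    have "{u \<in> {v}. {w, u} \<in> E} = (if {w, v} \<in> E then {v} else {})" for v w
      by auto
    then have deg: "deg_in E w {v} = (if {w, v} \<in> E then 1 else 0)" for v w
      by (simp add: deg_in_def)
    have "{e \<in> E. \<exists>u\<in>{a}. \<exists>v\<in>{b}. e = {u, v}} = (if {a, b} \<in> E then {{a, b}} else {})"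
      by auto
    then have "edges_between E {a} {b} = (if {a, b} \<in> E then 1 else 0)"
      by (simp add: edges_between_def)
    then show ?thesis
      using \<open>a \<noteq> b\<close> assms(2) unfolding degular_def P_def a_def[symmetric] b_def[symmetric]
      by (intro conjI exI[of _ "{}"]) (auto simp: deg insert_commute)
  qed
  then have "{j \<in> {1..n} - {i}. degular \<epsilon> E (P i) (P j)} = {1..n} - {i}" if "i \<in> {1..n}" for i
    using that by auto
  \<comment> \<open>Each part misses only its own index; \<open>n \<ge> 1 / \<epsilon>\<close>
    allows for that one.\<close>
  moreover have "(1 - \<epsilon>) * real n \<le> real n - 1"
    using assms by (simp add: field_simps)
  ultimately have "(1 - \<epsilon>) * real n \<le> real (card {j \<in> {1..n} - {i}. degular \<epsilon> E (P i) (P j)})"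
    if "i \<in> {1..n}" for i
    using that by (simp add: of_nat_diff)
  moreover have "(\<Union>i\<in>{1..n}. P i) = {..<n}"
    by (force simp: P_def image_iff intro: bexI[of _ "Suc _"])
  moreover have "disjoint_family_on P {1..n}"
    by (auto simp: disjoint_family_on_def P_def)
  moreover have "card (P i) = 1" for i by (simp add: P_def)
  ultimately have "degular_partition \<epsilon> {..<n} E n P"
    by (simp add: degular_partition_def)
  then show ?thesis unfolding has_degular_partition_def by blast
qed

section \<open>The lower bound on \<open>D\<close> and the choice of constants\<close>

theorem D_ge_tower:
  assumes "0 < \<epsilon>" "64 * \<epsilon> \<le> (1 / (32 * real s))\<^sup>2" "2 * i + 5 \<le> s" "x < real i + 1"
  shows "enat (tow x) \<le> D \<epsilon>"
proof -
  obtain m k c where "code_tower m k c" using ex_code_tower by blast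
  then interpret code_tower m k c .
  have s: "0 < s" using assms by simp
  \<comment> \<open>The bound \<open>16\<close> absorbs the loops; \<open>1 / \<epsilon>\<close>
    yields enough vertices for the graph to enter the supremum.\<close>
  define p where "p = max 16 (nat \<lceil>1 / \<epsilon>\<rceil>)"
  define V where "V = tower_verts s p"
  define E where "E = tower_edges s p"
  have "1 * p \<le> m s * (4 * s) * p"
    using m_pos[of s] s by (intro mult_le_mono1) (simp add: Suc_leI)
  then have "real p \<le> real (m s * (4 * s * p))"
    by (simp only: mult_1 mult.assoc of_nat_le_iff)
  moreover have "1 / \<epsilon> \<le> real p" unfolding p_def by linarith
  ultimately have ex: "has_degular_partition \<epsilon> V E (m s * (4 * s * p))"
    unfolding V_def tower_verts_def using assms by (intro singleton_degular_partition) auto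
  then have "has_degular_partition \<epsilon> V E (min_complexity \<epsilon> V E)"
    unfolding min_complexity_def by (rule LeastI)
  then have "m s \<le> 2 * min_complexity \<epsilon> V E"
    using tower_graph_complexity[OF s _ assms(1,2), of p] unfolding has_degular_partition_def V_def E_def p_def
    by fastforce
  moreover have "2 * tow x \<le> m s"
    using tow_le_m[OF assms(4)] m_mono[OF assms(3)] by linarith
  ultimately have "enat (tow x) \<le> enat (min_complexity \<epsilon> V E)" by simp
  also have "\<dots> \<le> D \<epsilon>"
    unfolding D_def using ex tower_graph[of s p]
    by (intro SUP_upper2[of "(V, E)"]) (auto simp: V_def E_def)
  finally show ?thesis .
qed

theorem theorem1p2:
  shows "\<exists>c>0::real. \<exists>\<epsilon>0>0::real. \<forall>\<epsilon>. 0 < \<epsilon> \<and> \<epsilon> < \<epsilon>0 \<longrightarrow>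
           D \<epsilon> \<ge> enat (tow (c * \<epsilon> powr (- 1 / 3)))"
proof (intro exI conjI allI impI)
  \<comment> \<open>The threshold makes \<open>T > 2560\<close>, so that \<open>s \<ge> 5\<close>
    leaves room for the offset in \<open>tow_le_m\<close>.\<close>
  fix \<epsilon> :: real assume \<epsilon>: "0 < \<epsilon> \<and> \<epsilon> < 1 / 2560 ^ 3"
  define T where "T = \<epsilon> powr (- 1 / 3)"
  have T3: "T ^ 3 = 1 / \<epsilon>"
    using \<epsilon> by (simp add: T_def powr_power powr_neg_one)
  have "2560 ^ 3 < T ^ 3" unfolding T3 using \<epsilon> by (simp add: field_simps)
  then have T: "2560 < T" by (rule power_less_imp_less_base) (simp add: T_def)
  \<comment> \<open>The condition on \<open>s\<close> reads
    \<open>65536 * s\<^sup>2 * \<epsilon> \<le> 1\<close> with \<open>65536 = 256\<^sup>2\<close>.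
    For \<open>s \<le> T / 256\<close> it follows from
    \<open>T\<^sup>2 \<le> T ^ 3 = 1 / \<epsilon>\<close>.\<close>
  define s where "s = nat \<lfloor>T / 256\<rfloor>"
  define i where "i = (s - 5) div 2"
  have s: "real s \<le> T / 256" "T / 256 < real s + 1"
    using T unfolding s_def by linarith+
  then have s5: "5 \<le> s" "0 < real s" using T by linarith+
  then have i: "2 * i + 5 \<le> s" "s \<le> 2 * i + 6" by (auto simp: i_def)
  have "real s * real s \<le> (T / 256) * (T / 256)" using s T by (intro mult_mono) auto
  also have "\<dots> \<le> T ^ 3 / 65536" using T by (simp add: power3_eq_cube)
  finally have "\<epsilon> * (65536 * (real s)\<^sup>2) \<le> 1"
    using \<epsilon> unfolding T3 by (simp add: field_simps power2_eq_square)
  then have "64 * \<epsilon> \<le> (1 / (32 * real s))\<^sup>2"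
    using s5 by (simp add: field_simps power2_eq_square)
  \<comment> \<open>From \<open>T / 256 < s + 1 \<le> 2 * i + 7\<close>, division by
    \<open>8\<close> gives \<open>T / 2048 < i + 1\<close>.\<close>
  moreover have "1 / 2048 * T < real i + 1" using s T i by linarith
  ultimately show "enat (tow (1 / 2048 * \<epsilon> powr (- 1 / 3))) \<le> D \<epsilon>"
    using \<epsilon> i unfolding T_def by (intro D_ge_tower) auto
qed auto

end
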